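(* Let $q$ be a prime power. Let $P\in\mathbb{F}_q[x,y]$ satisfy $P(0,0)=0$ and $\frac{\partial P}{\partial y}(0,0)\neq 0$, and let $h=\deg_x P$ and $d=\deg_y P$. Let $F=\sum_{n\ge 0}a(n)x^n\in\mathbb{F}_q[[x]]\setminus\{0\}$ be the Furstenberg series associated with $P$. Then the minimal $q$-automaton that generates $a(n)_{n\ge 0}$ has size (number of states) at most $$q^{hd}+q^{(h-1)(d-1)}\,\mathcal{L}(h,d,d)+\lfloor\log_q h\rfloor+\lfloor\log_q\max(h,d)\rfloor+3.$$
   Context: Furstenberg series: for $P\in\mathbb{F}_q[x,y]$ with $P(0,0)=0$ and $\frac{\partial P}{\partial y}(0,0)\ne 0$, the Furstenberg series associated with $P$ is the unique $F\in\mathbb{F}_q[[x]]$ with $F(0)=0$ and $P(x,F)=0$. The height of $P$ is $\deg_x P$ and the degree of $P$ is $\deg_y P$. (The conditions on $P$ force $d\ge 1$, and $F\neq 0$ forces $h\ge 1$.) For a positive integer $n$, $\mathrm{parts}(n)$ is the set of integer partitions of $n$, and for a partition $\sigma$, $\mathrm{lcm}(\sigma)$ is the least common multiple of its parts. Define $$\mathcal{L}(l,m,n)=\max_{1\le i\le l,\ 1\le j\le m,\ 1\le k\le n}\ \max_{\sigma_1\in\mathrm{parts}(i),\ \sigma_2\in\mathrm{parts}(j),\ \sigma_3\in\mathrm{parts}(k)}\mathrm{lcm}\big(\mathrm{lcm}(\sigma_1),\mathrm{lcm}(\sigma_2),\mathrm{lcm}(\sigma_3)\big).$$ Automata: a $q$-automaton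 is a deterministic finite automaton with output, with input alphabet $\{0,1,\dots,q-1\}$. It generates $a(n)_{n\ge0}$ if its output is $a(n)$ when fed the standard base-$q$ representation of $n$, starting with the least significant digit. It is not affected by leading $0$s if it also outputs $a(n)$ when fed any base-$q$ representation of $n$ padded with leading $0$s (again least significant digit first). The minimal $q$-automaton of $a(n)_{n\ge 0}$ is the smallest automaton that generates $a(n)_{n\ge0}$ and is not affected by leading $0$s. Equivalently, its states are in bijection with the $q$-kernel $\ker_q(a(n)_{n\ge0})=\{a(q^e n+r)_{n\ge0}: e\ge 0,\ 0\le r\le q^e-1\}$, so its size is $|\ker_q(a(n)_{n\ge0})|$. *)

theory Defs
  imports
    Complex_Main
    "HOL-Library.Cardinality"
    "HOL-Library.Multiset"
    "HOL-Computational_Algebra.Polynomial_FPS"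
begin

text \<open>
  A polynomial in \<open>x\<close> and \<open>y\<close> is an element of \<^typ>\<open>'a poly poly\<close>, where the outer variable
  is \<open>y\<close> and the coefficients are polynomials in \<open>x\<close>. Thus the degree in \<open>y\<close> is
  \<^const>\<open>degree\<close>, the partial derivative with respect to \<open>y\<close> is \<^const>\<open>pderiv\<close>, and
  the value at \<open>(0, 0)\<close> is \<open>poly (poly P 0) 0\<close>.
\<close>

definition degree_x :: "'a::zero poly poly \<Rightarrow> nat" where
  "degree_x P = (MAX i\<in>{..degree P}. degree (coeff P i))"

definition furstenberg_poly :: "'a::field poly poly \<Rightarrow> bool" where
  "furstenberg_poly P \<longleftrightarrow> poly (poly P 0) 0 = 0 \<and> poly (poly (pderiv P) 0) 0 \<noteq> 0"

definition furstenberg_series :: "'a::field poly poly \<Rightarrow> 'a fps \<Rightarrow> bool" where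
  "furstenberg_series P F \<longleftrightarrow> fps_nth F 0 = 0 \<and> poly (map_poly fps_of_poly P) F = 0"

definition parts :: "nat \<Rightarrow> nat multiset set" where
  "parts n = {\<sigma>. 0 \<notin># \<sigma> \<and> sum_mset \<sigma> = n}"

definition partition_lcm :: "nat multiset \<Rightarrow> nat" where
  "partition_lcm \<sigma> = Lcm (set_mset \<sigma>)"

definition landau_lcm :: "nat \<Rightarrow> nat \<Rightarrow> nat \<Rightarrow> nat" where
  "landau_lcm l m n =
     Max {lcm (lcm (partition_lcm \<sigma>\<^sub>1) (partition_lcm \<sigma>\<^sub>2)) (partition_lcm \<sigma>\<^sub>3)
          | i j k \<sigma>\<^sub>1 \<sigma>\<^sub>2 \<sigma>\<^sub>3.
            i \<in> {1..l} \<and> j \<in> {1..m} \<and> k \<in> {1..n} \<and>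
            \<sigma>\<^sub>1 \<in> parts i \<and> \<sigma>\<^sub>2 \<in> parts j \<and> \<sigma>\<^sub>3 \<in> parts k}"

text \<open>
  The standard base-\<open>q\<close> representation, least significant digit first. The representation
  of \<open>0\<close> is the empty word. The guard \<open>q < 2\<close> only ensures termination.
\<close>

fun base_digits :: "nat \<Rightarrow> nat \<Rightarrow> nat list" where
  "base_digits q n =
     (if n = 0 \<or> q < 2 then [] else n mod q # base_digits q (n div q))"

declare base_digits.simps [simp del]

text \<open>
  States are taken to be natural numbers. This does not affect which sizes occur, since the
  states of any finite automaton can be relabelled.
\<close>

record 'b automaton =
  states :: "nat set"
  initial :: nat
  trans_fun :: "nat \<Rightarrow> nat \<Rightarrow> nat"
  out_fun :: "nat \<Rightarrow> 'b"

definition q_automaton :: "nat \<Rightarrow> 'b automaton \<Rightarrow> bool" where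
  "q_automaton q M \<longleftrightarrow>
     finite (states M) \<and> initial M \<in> states M \<and>
     (\<forall>s\<in>states M. \<forall>c<q. trans_fun M s c \<in> states M)"

definition output_on :: "'b automaton \<Rightarrow> nat list \<Rightarrow> 'b" where
  "output_on M w = out_fun M (foldl (trans_fun M) (initial M) w)"

definition generates :: "nat \<Rightarrow> 'b automaton \<Rightarrow> (nat \<Rightarrow> 'b) \<Rightarrow> bool" where
  "generates q M a \<longleftrightarrow> (\<forall>n. output_on M (base_digits q n) = a n)"

text \<open>Leading zeros are appended on the right, because the most significant digit is read last.\<close>

definition unaffected_by_leading_zeros :: "nat \<Rightarrow> 'b automaton \<Rightarrow> (nat \<Rightarrow> 'b) \<Rightarrow> bool" where
  "unaffected_by_leading_zeros q M a \<longleftrightarrow>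
     (\<forall>n k. output_on M (base_digits q n @ replicate k 0) = a n)"

definition admissible_automaton :: "nat \<Rightarrow> (nat \<Rightarrow> 'b) \<Rightarrow> 'b automaton \<Rightarrow> bool" where
  "admissible_automaton q a M \<longleftrightarrow>
     q_automaton q M \<and> generates q M a \<and> unaffected_by_leading_zeros q M a"

definition minimal_automaton :: "nat \<Rightarrow> (nat \<Rightarrow> 'b) \<Rightarrow> 'b automaton \<Rightarrow> bool" where
  "minimal_automaton q a M \<longleftrightarrow>
     admissible_automaton q a M \<and>
     (\<forall>M'. admissible_automaton q a M' \<longrightarrow> card (states M) \<le> card (states M'))"

end

theory Submission
  imports Defs "HOL-Computational_Algebra.Polynomial_Factorial"
begin

text \<open>
  Write \<open>P\<^sub>y\<close> for the partial derivative. To a polynomial \<open>S(x, y)\<close> attach the series \<open>S(x, F) / P\<^sub>y(x, F)\<close>,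
  the residue at \<open>y = F\<close> of \<open>S / P dy\<close>. Since \<open>S / P = S P^(q - 1) / P(x^q, y^q)\<close>, the section
  \<open>a(n) \<mapsto> a(q n + r)\<close> of this series is attached to the polynomial formed by the coefficients of
  \<open>x^(q i + r) y^(q j + q - 1)\<close> in \<open>S P^(q - 1)\<close>. The series \<open>F\<close> itself comes from \<open>y P\<^sub>y - d P\<close>, so all
  states have degree at most \<open>h\<close> in \<open>x\<close> and \<open>d - 1\<close> in \<open>y\<close>, and once a nonzero digit has been read
  degree at most \<open>h - 1\<close> in \<open>x\<close>. This accounts for \<open>q^(h d)\<close> states.

  The remaining states form the orbit under the digit \<open>0\<close>. There the coefficients of \<open>y^(d - 1)\<close>, of
  \<open>x^0\<close> and of \<open>x^h\<close> evolve autonomously by univariate operators \<open>u \<mapsto> \<Lambda>\<^sub>0(u p^(q - 1))\<close>, which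
  act as \<open>\<Lambda>\<^sub>0\<close> on \<open>u / p\<close>. If the irreducible factors of \<open>p\<close> have degrees dividing \<open>l\<close>, then \<open>p\<close>
  divides a power of \<open>X^(q^l) - X\<close>, and the operator has period \<open>l\<close> after about \<open>log\<^sub>q (max h d)\<close>
  steps. The \<open>(h - 1) (d - 1)\<close> inner coefficients are bounded trivially.
\<close>

subsection \<open>Frobenius and sections\<close>

lemma card_field_gt_1: "CARD('a::{field,finite}) > 1"
proof -
  have "card {0, 1 :: 'a} \<le> CARD('a)"
    by (intro card_mono) auto
  then show ?thesis by simp
qed

lemma card_field_pos: "CARD('a::{field,finite}) > 0"
  using card_field_gt_1[where 'a = 'a] by simp

text \<open>For \<open>c \<noteq> 0\<close>, multiplication by \<open>c\<close> permutes the nonzero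
  elements; comparing their products gives \<open>c ^ (q - 1) = 1\<close>.\<close>

lemma power_card_field:
  fixes c :: "'a::{field,finite}"
  shows "c ^ CARD('a) = c"
proof (cases "c = 0")
  case False
  have "(\<Prod>y\<in>UNIV-{0}. c * y) = (\<Prod>y\<in>UNIV-{0}. y)"
    by (rule prod.reindex_bij_witness[of _ "\<lambda>y. y / c" "\<lambda>y. c * y"]) (use False in auto)
  then have "c ^ (CARD('a) - 1) = 1"
    by (simp add: prod.distrib)
  then show ?thesis
    using card_field_pos[where 'a = 'a] by (metis One_nat_def Suc_pred mult_1_right power_Suc)
qed (use card_field_pos[where 'a = 'a] in simp)

text \<open>The polynomial \<open>(X + 1)^q - X^q - 1\<close> has degree less than \<open>q\<close> and \<open>q\<close> roots, so it vanishes.\<close>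

lemma of_nat_card_choose:
  assumes "0 < i" "i < CARD('a::{field,finite})"
  shows "of_nat (CARD('a) choose i) = (0 :: 'a)"
proof -
  let ?q = "CARD('a)"
  define p :: "'a poly" where "p = (\<Sum>i\<in>{0<..<?q}. monom (of_nat (?q choose i)) i)"
  have "poly p x = 0" for x
  proof -
    have "(x + 1) ^ ?q = (\<Sum>k\<le>?q. of_nat (?q choose k) * x ^ k)"
      by (simp add: binomial_ring)
    also have "{..?q} = insert 0 (insert ?q {0<..<?q})"
      using card_field_pos[where 'a = 'a] by auto
    also have "(\<Sum>k\<in>\<dots>. of_nat (?q choose k) * x ^ k) = 1 + (x ^ ?q + poly p x)"
      using card_field_pos[where 'a = 'a]
      by (simp add: p_def poly_sum poly_monom)
    finally show ?thesis
      by (simp add: power_card_field)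
  qed
  then have "{x. poly p x = 0} = UNIV"
    by auto
  moreover have "degree p \<le> ?q - 1"
    unfolding p_def by (intro degree_sum_le) (auto intro: order.trans[OF degree_monom_le])
  ultimately have "p = 0"
    using card_poly_roots_bound[of p] card_field_pos[where 'a = 'a] by (metis One_nat_def Suc_pred not_less_eq_eq order.trans)
  then have "coeff p i = 0"
    by simp
  then show ?thesis
    using assms by (simp add: p_def coeff_sum)
qed

text \<open>Stated for any commutative ring in which the inner binomial coefficients vanish, so that
  it serves polynomials, power series and polynomials over power series alike.\<close>

lemma frobenius_add:
  fixes a b :: "'r::comm_ring_1"
  assumes "0 < q" "\<And>i. 0 < i \<Longrightarrow> i < q \<Longrightarrow> of_nat (q choose i) = (0 :: 'r)"
  shows "(a + b) ^ q = a ^ q + b ^ q"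
proof -
  have "(a + b) ^ q = (\<Sum>k\<le>q. of_nat (q choose k) * a ^ k * b ^ (q - k))"
    by (rule binomial_ring)
  also have "\<dots> = (\<Sum>k\<in>{0, q}. of_nat (q choose k) * a ^ k * b ^ (q - k))"
    using assms by (intro sum.mono_neutral_right) auto
  finally show ?thesis
    using assms(1) by (simp add: add.commute)
qed

lemma frobenius_add_poly:
  fixes f g :: "'a::{field,finite} poly"
  shows "(f + g) ^ CARD('a) = f ^ CARD('a) + g ^ CARD('a)"
  by (rule frobenius_add) (auto simp: card_field_pos of_nat_card_choose of_nat_poly)

lemma of_nat_card_choose_fps:
  assumes "0 < i" "i < CARD('a::{field,finite})"
  shows "of_nat (CARD('a) choose i) = (0 :: 'a fps)"
  using assms by (simp add: of_nat_card_choose flip: fps_of_nat)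

lemma frobenius_add_fps:
  fixes f g :: "'a::{field,finite} fps"
  shows "(f + g) ^ CARD('a) = f ^ CARD('a) + g ^ CARD('a)"
  by (rule frobenius_add) (auto simp: card_field_pos of_nat_card_choose_fps)

lemma frobenius_diff_fps_poly:
  fixes f g :: "'a::{field,finite} fps poly"
  shows "(f - g) ^ CARD('a) = f ^ CARD('a) - g ^ CARD('a)"
proof -
  have "((f - g) + g) ^ CARD('a) = (f - g) ^ CARD('a) + g ^ CARD('a)"
    by (rule frobenius_add) (auto simp: card_field_pos of_nat_card_choose_fps of_nat_poly)
  then show ?thesis by (simp add: eq_diff_eq)
qed

text \<open>After splitting \<open>f\<close> into its constant term and \<open>x\<close> times a
  shift, the Frobenius map reduces the coefficient at \<open>n\<close> to the one at
  \<open>n - q\<close> for the shifted series.\<close>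

lemma fps_nth_power_card:
  fixes f :: "'a::{field,finite} fps"
  shows "fps_nth (f ^ CARD('a)) n = (if CARD('a) dvd n then fps_nth f (n div CARD('a)) else 0)"
proof (induction n arbitrary: f rule: less_induct)
  case (less n)
  let ?q = "CARD('a)"
  have q: "?q > 0" by (rule card_field_pos)
  have "f = fps_const (fps_nth f 0) + fps_X * fps_shift 1 f"
    by (rule fps_ext) (simp add: fps_X_mult_nth)
  then have "f ^ ?q = (fps_const (fps_nth f 0) + fps_X * fps_shift 1 f) ^ ?q"
    by (rule arg_cong)
  also have "\<dots> = fps_const (fps_nth f 0) + fps_X ^ ?q * fps_shift 1 f ^ ?q"
    by (simp only: frobenius_add_fps power_mult_distrib fps_const_power power_card_field)
  finally have eq: "fps_nth (f ^ ?q) n =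
      (if n = 0 then fps_nth f 0 else 0) + (if n < ?q then 0 else fps_nth (fps_shift 1 f ^ ?q) (n - ?q))"
    by (simp add: fps_X_power_mult_nth)
  show ?case
  proof (cases "n < ?q")
    case True
    then show ?thesis using q eq by (auto dest: dvd_imp_le)
  next
    case False
    then have "fps_nth (f ^ ?q) n = fps_nth (fps_shift 1 f ^ ?q) (n - ?q)"
      using eq q by auto
    also have "\<dots> = (if ?q dvd n - ?q then fps_nth (fps_shift 1 f) ((n - ?q) div ?q) else 0)"
      using False q by (intro less) linarith
    also have "(n - ?q) div ?q + 1 = n div ?q"
      using False q by (simp add: le_div_geq)
    then have "fps_nth (fps_shift 1 f) ((n - ?q) div ?q) = fps_nth f (n div ?q)"
      by simp
    also have "?q dvd n - ?q \<longleftrightarrow> ?q dvd n"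
      using False by (simp add: dvd_minus_self)
    finally show ?thesis .
  qed
qed

section \<open>Sections of power series and polynomials\<close>

definition fps_section :: "nat \<Rightarrow> nat \<Rightarrow> 'a fps \<Rightarrow> 'a fps" where
  "fps_section q r f = Abs_fps (\<lambda>n. fps_nth f (q * n + r))"

lemma fps_nth_section [simp]: "fps_nth (fps_section q r f) n = fps_nth f (q * n + r)"
  by (simp add: fps_section_def)

definition poly_section :: "nat \<Rightarrow> nat \<Rightarrow> 'a::zero poly \<Rightarrow> 'a poly" where
  "poly_section q r p = Abs_poly (\<lambda>n. coeff p (q * n + r))"

lemma coeff_poly_section [simp]:
  assumes "q > 0"
  shows "coeff (poly_section q r p) n = coeff p (q * n + r)"
proof -
  have "coeff p (q * n + r) = 0" if "degree p < n" for n
  proof (rule coeff_eq_0)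
    have "n \<le> q * n" using assms by simp
    then show "degree p < q * n + r" using that by linarith
  qed
  then show ?thesis
    unfolding poly_section_def by (subst coeff_Abs_poly[where n = "degree p"]) auto
qed

lemma poly_section_0 [simp]: "q > 0 \<Longrightarrow> poly_section q r 0 = 0"
  by (simp add: poly_eq_iff)

lemma fps_section_sum: "fps_section q r (\<Sum>i\<in>A. f i) = (\<Sum>i\<in>A. fps_section q r (f i))"
  by (simp add: fps_eq_iff fps_sum_nth)

lemma fps_section_of_poly:
  "q > 0 \<Longrightarrow> fps_section q r (fps_of_poly p) = fps_of_poly (poly_section q r p)"
  by (simp add: fps_eq_iff)

text \<open>The series \<open>g ^ q\<close> carries the coefficients of \<open>g\<close> at the
  multiples of \<open>q\<close> and is zero elsewhere, so it leaves the section as the factor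
  \<open>g\<close>.\<close>

lemma fps_section_mult_power:
  fixes f g :: "'a::{field,finite} fps"
  assumes "r < CARD('a)"
  shows "fps_section CARD('a) r (f * g ^ CARD('a)) = fps_section CARD('a) r f * g"
proof (rule fps_ext)
  fix n
  let ?q = "CARD('a)"
  have q: "?q > 0" by (rule card_field_pos)
  have "fps_nth (g ^ ?q * f) (?q * n + r) =
      (\<Sum>i\<in>{0..?q * n + r}. fps_nth (g ^ ?q) i * fps_nth f (?q * n + r - i))"
    by (simp add: fps_mult_nth)
  also have "\<dots> = (\<Sum>i\<in>(\<lambda>j. ?q * j) ` {0..n}. fps_nth (g ^ ?q) i * fps_nth f (?q * n + r - i))"
  proof (intro sum.mono_neutral_right ballI)
    show "(\<lambda>j. ?q * j) ` {0..n} \<subseteq> {0..?q * n + r}"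
      by (intro subsetI) (auto intro!: trans_le_add1 mult_le_mono2)
    fix i assume i: "i \<in> {0..?q * n + r} - (\<lambda>j. ?q * j) ` {0..n}"
    \<comment> \<open>Since \<open>r < q\<close>, the multiples of \<open>q\<close> up to
      \<open>q * n + r\<close> are those up to \<open>q * n\<close>.\<close>
    have "\<not> ?q dvd i"
    proof
      assume "?q dvd i"
      then obtain j where j: "i = ?q * j" by auto
      with i have "?q * j \<le> ?q * n + r" "j > n" by auto
      then have "?q * Suc n \<le> ?q * n + r"
        using mult_le_mono2[of "Suc n" j ?q] by linarith
      with assms show False by simp
    qed
    then show "fps_nth (g ^ ?q) i * fps_nth f (?q * n + r - i) = 0"
      by (simp add: fps_nth_power_card)
  qed auto
  also have "\<dots> = (\<Sum>j\<in>{0..n}. fps_nth g j * fps_nth f (?q * n + r - ?q * j))"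
    using q by (subst sum.reindex) (auto simp: inj_on_def fps_nth_power_card)
  also have "\<dots> = (\<Sum>j\<in>{0..n}. fps_nth g j * fps_nth (fps_section ?q r f) (n - j))"
    by (intro sum.cong) (auto simp: algebra_simps diff_mult_distrib2)
  also have "\<dots> = fps_nth (g * fps_section ?q r f) n"
    by (simp add: fps_mult_nth)
  finally show "fps_nth (fps_section ?q r (f * g ^ ?q)) n = fps_nth (fps_section ?q r f * g) n"
    by (simp add: mult.commute)
qed

lemma poly_section_mult_power:
  fixes f g :: "'a::{field,finite} poly"
  assumes "r < CARD('a)"
  shows "poly_section CARD('a) r (f * g ^ CARD('a)) = poly_section CARD('a) r f * g"
  using fps_section_mult_power[OF assms, of "fps_of_poly f" "fps_of_poly g"]
  by (simp add: fps_section_of_poly card_field_pos fps_of_poly_eq_iff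
      flip: fps_of_poly_power fps_of_poly_mult)

subsection \<open>Iterating a univariate Cartier operator\<close>

text \<open>Numerator, over the unchanged denominator \<open>p\<close>, of the section with residue
  0 of \<open>u / p\<close>, written as \<open>u * p ^ (q - 1) / p ^ q\<close>.\<close>

definition cartier :: "'a::{field,finite} poly \<Rightarrow> 'a poly \<Rightarrow> 'a poly" where
  "cartier p u = poly_section CARD('a) 0 (u * p ^ (CARD('a) - 1))"

text \<open>Expanding the fraction \<open>u / p\<close> by \<open>c\<close> is compatible with the
  section, as \<open>c * c ^ (q - 1)\<close> is a \<open>q\<close>-th power. This allows passing to
  a convenient multiple of the denominator.\<close>

lemma cartier_mult_both:
  fixes p c u :: "'a::{field,finite} poly"
  shows "cartier (p * c) (u * c) = cartier p u * c"
proof -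
  have "c * c ^ (CARD('a) - 1) = c ^ CARD('a)"
    using card_field_pos[where 'a = 'a] by (metis power_minus_mult mult.commute)
  then have "u * c * (p * c) ^ (CARD('a) - 1) = (u * p ^ (CARD('a) - 1)) * c ^ CARD('a)"
    by (metis (no_types, lifting) power_mult_distrib mult.assoc mult.left_commute)
  then show ?thesis
    unfolding cartier_def by (simp only: poly_section_mult_power[OF card_field_pos])
qed

lemma cartier_funpow_mult_both: "(cartier (p * c) ^^ n) (u * c) = (cartier p ^^ n) u * c"
  by (induction n) (simp_all add: cartier_mult_both)

lemma coeff_poly_section_funpow:
  "q > 0 \<Longrightarrow> coeff ((poly_section q 0 ^^ k) f) n = coeff f (q ^ k * n)"
  by (induction k arbitrary: n) (simp_all add: mult.left_commute mult.assoc)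

lemma poly_section_funpow_mult_power:
  fixes f g :: "'a::{field,finite} poly"
  shows "(poly_section CARD('a) 0 ^^ k) (f * g ^ (CARD('a) ^ k)) = (poly_section CARD('a) 0 ^^ k) f * g"
proof (induction k arbitrary: g)
  case (Suc k)
  have "g ^ (CARD('a) ^ Suc k) = (g ^ CARD('a)) ^ (CARD('a) ^ k)"
    by (simp add: power_mult)
  then show ?case
    by (simp add: Suc poly_section_mult_power card_field_pos)
qed simp

text \<open>In the induction step \<open>q ^ Suc k - 1\<close> splits as
  \<open>(q ^ k - 1) + (q - 1) * q ^ k\<close>; the second summand yields a \<open>q ^ k\<close>-th
  power, which passes through \<open>k\<close> sections.\<close>

lemma cartier_funpow:
  fixes p u :: "'a::{field,finite} poly"
  shows "(cartier p ^^ k) u = (poly_section CARD('a) 0 ^^ k) (u * p ^ (CARD('a) ^ k - 1))"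
proof (induction k)
  case (Suc k)
  let ?q = "CARD('a)"
  have "?q ^ k \<ge> 1" using card_field_pos[where 'a = 'a] by simp
  then have "?q ^ k - 1 + (?q - 1) * ?q ^ k = ?q ^ Suc k - 1"
    using card_field_pos[where 'a = 'a] by (simp add: algebra_simps diff_mult_distrib)
  then have e: "p ^ (?q ^ Suc k - 1) = p ^ (?q ^ k - 1) * (p ^ (?q - 1)) ^ (?q ^ k)"
    by (metis power_add power_mult)
  have "(cartier p ^^ Suc k) u
      = poly_section ?q 0 ((poly_section ?q 0 ^^ k) (u * p ^ (?q ^ k - 1)) * p ^ (?q - 1))"
    by (simp add: Suc cartier_def)
  also have "\<dots> = (poly_section ?q 0 ^^ Suc k) (u * p ^ (?q ^ k - 1) * (p ^ (?q - 1)) ^ (?q ^ k))"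
    by (simp add: poly_section_funpow_mult_power)
  finally show ?case
    by (simp only: e mult.assoc)
qed simp

text \<open>For \<open>l > 0\<close> this is the product of the monic irreducible polynomials whose
  degree divides \<open>l\<close>, so its powers serve as common denominators.\<close>

definition frob_poly :: "nat \<Rightarrow> 'a::{field,finite} poly" where
  "frob_poly l = monom 1 (CARD('a) ^ l) - monom 1 1"

lemma power_monom_1: "monom (1 :: 'a::comm_semiring_1) m ^ n = monom 1 (m * n)"
  by (simp add: monom_power)

lemma frobenius_add_poly_power:
  fixes f g :: "'a::{field,finite} poly"
  shows "(f + g) ^ (CARD('a) ^ k) = f ^ (CARD('a) ^ k) + g ^ (CARD('a) ^ k)"
  by (induction k) (simp_all add: power_mult frobenius_add_poly mult.commute[of "CARD('a)"])

lemma frobenius_diff_poly_power: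
  fixes f g :: "'a::{field,finite} poly"
  shows "(f - g) ^ (CARD('a) ^ k) = f ^ (CARD('a) ^ k) - g ^ (CARD('a) ^ k)"
  using frobenius_add_poly_power[of "f - g" g k] by (simp add: eq_diff_eq)

lemma card_field_power_gt_1:
  "l > 0 \<Longrightarrow> CARD('a::{field,finite}) ^ l > 1"
  by (rule one_less_power[OF card_field_gt_1])

lemma degree_frob_poly:
  assumes "l > 0"
  shows "degree (frob_poly l :: 'a::{field,finite} poly) = CARD('a) ^ l"
  unfolding frob_poly_def using card_field_power_gt_1[OF assms, where 'a = 'a]
  by (simp add: diff_conv_add_uminus degree_add_eq_left degree_monom_eq del: add_uminus_conv_diff)

lemma frob_poly_nonzero:
  assumes "l > 0"
  shows "(frob_poly l :: 'a::{field,finite} poly) \<noteq> 0"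
proof
  assume "(frob_poly l :: 'a poly) = 0"
  then show False
    using degree_frob_poly[OF assms, where 'a = 'a] card_field_power_gt_1[OF assms, where 'a = 'a]
    by simp
qed

text \<open>With \<open>D l\<close> for \<open>frob_poly l\<close>, induction on \<open>t\<close>
  using \<open>D (m * Suc t) = D (m * t) ^ (q ^ m) + D m\<close>.\<close>

lemma frob_poly_dvd:
  assumes "m dvd n"
  shows "(frob_poly m :: 'a::{field,finite} poly) dvd frob_poly n"
proof -
  have "(frob_poly m :: 'a poly) dvd frob_poly (m * t)" for t
  proof (induction t)
    case (Suc t)
    have "(frob_poly (m * Suc t) :: 'a poly) = frob_poly (m * t) ^ (CARD('a) ^ m) + frob_poly m"
      by (simp add: frob_poly_def frobenius_diff_poly_power power_monom_1 power_add mult.commute)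
    moreover have "(frob_poly (m * t) :: 'a poly) dvd frob_poly (m * t) ^ (CARD('a) ^ m)"
      using card_field_pos[where 'a = 'a] by (intro dvd_power) simp
    ultimately show ?case
      using Suc by (metis dvd_add dvd_refl dvd_trans)
  qed (simp add: frob_poly_def)
  then show ?thesis
    using assms by auto
qed

text \<open>By Frobenius the \<open>M\<close>-th power is \<open>(X^M)^M - X^M\<close>, a difference
  of \<open>M\<close>-th powers; dividing by \<open>X^M - X\<close> leaves the geometric
  sum.\<close>

lemma frob_poly_power_pred:
  assumes "l > 0"
  defines "M \<equiv> CARD('a) ^ l"
  shows "(frob_poly l :: 'a::{field,finite} poly) ^ (M - 1) = (\<Sum>i<M. monom 1 (M * i + (M - Suc i)))"
proof -
  let ?D = "frob_poly l :: 'a poly"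
  have M: "M > 1" unfolding M_def by (rule card_field_power_gt_1[OF assms(1)])
  have "?D * ?D ^ (M - 1) = ?D ^ M"
    using M by (metis power_eq_if not_one_less_zero)
  also have "\<dots> = monom 1 M ^ M - monom 1 1 ^ M"
    unfolding M_def by (simp add: frob_poly_def frobenius_diff_poly_power)
  also have "\<dots> = ?D * (\<Sum>i<M. monom 1 1 ^ (M - Suc i) * monom 1 M ^ i)"
    by (simp add: power_diff_sumr2 frob_poly_def M_def)
  also have "(\<Sum>i<M. monom 1 1 ^ (M - Suc i) * monom 1 M ^ i)
      = (\<Sum>i<M. monom (1 :: 'a) (M * i + (M - Suc i)))"
    by (intro sum.cong) (simp_all add: power_monom_1 mult_monom add.commute)
  finally show ?thesis
    using frob_poly_nonzero[OF assms(1), where 'a = 'a] by simp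
qed

text \<open>A rational function \<open>w / (X^M - X)\<close> that is regular at \<open>0\<close> and of degree at most \<open>0\<close> has a
  coefficient sequence which is periodic modulo \<open>M - 1\<close> from index \<open>1\<close> on, and \<open>M \<equiv> 1\<close>.\<close>

lemma cartier_frob_poly_funpow:
  fixes w :: "'a::{field,finite} poly"
  assumes "l > 0" "coeff w 0 = 0" "degree w \<le> CARD('a) ^ l"
  shows "(cartier (frob_poly l) ^^ l) w = w"
proof (rule poly_eqI)
  fix n
  define M where "M = CARD('a) ^ l"
  have M: "M > 1" unfolding M_def by (rule card_field_power_gt_1[OF assms(1)])
  have w: "coeff w j = 0" if "j = 0 \<or> j > M" for j
    using that assms by (auto simp: M_def coeff_eq_0)
  have "coeff ((cartier (frob_poly l) ^^ l) w) n
      = coeff (\<Sum>i<M. w * monom 1 (M * i + (M - Suc i))) (M * n)"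
    using frob_poly_power_pred[OF assms(1), where 'a = 'a]
    by (simp add: cartier_funpow coeff_poly_section_funpow card_field_pos sum_distrib_left flip: M_def)
  also have "\<dots> = (\<Sum>i<M. if M * i + (M - Suc i) \<le> M * n
      then coeff w (M * n - (M * i + (M - Suc i))) else 0)"
    by (simp add: coeff_sum mult.commute[of w] coeff_monom_mult)
      (intro sum.cong; simp add: not_less)
  also have "\<dots> = (\<Sum>i<M. if n = Suc i then coeff w n else 0)"
  proof (rule sum.cong)
    fix i assume i: "i \<in> {..<M}"
    \<comment> \<open>The index \<open>M * n - (M * i + (M - Suc i))\<close> equals \<open>n\<close>
      if \<open>n = Suc i\<close>, is truncated to 0 for smaller \<open>n\<close> and exceeds
      \<open>M\<close> for larger \<open>n\<close>; \<open>w\<close> vanishes at 0 and beyond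
      \<open>M\<close>.\<close>
    consider "n = Suc i" | "n \<le> i" | "n \<ge> i + 2" by linarith
    then show "(if M * i + (M - Suc i) \<le> M * n
      then coeff w (M * n - (M * i + (M - Suc i))) else 0) = (if n = Suc i then coeff w n else 0)"
    proof cases
      case 1
      then show ?thesis using i by auto
    next
      case 2
      then have "M * n \<le> M * i" by simp
      then have "M * n - (M * i + (M - Suc i)) = 0" by linarith
      then show ?thesis using 2 w[of 0] by simp
    next
      case 3
      then have "M * (i + 2) \<le> M * n" by (intro mult_le_mono2)
      then have "M * n - (M * i + (M - Suc i)) > M"
        using i M by (simp add: algebra_simps)
      then show ?thesis using 3 w by auto
    qed
  qed simp
  also have "\<dots> = coeff w n"
  proof (cases "n \<in> {1..M}")
    case True
    then have "(\<Sum>i<M. if n = Suc i then coeff w n else 0) = (\<Sum>i<M. if n - 1 = i then coeff w n else 0)"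
      by (intro sum.cong) auto
    then show ?thesis using True by auto
  next
    case False
    then have "coeff w n = 0" using w by auto
    then show ?thesis by (auto intro!: sum.neutral)
  qed
  finally show "coeff ((cartier (frob_poly l) ^^ l) w) n = coeff w n" .
qed

text \<open>With \<open>D = X^(q^l) - X\<close> and \<open>Q = q^k\<close>, write \<open>D^Q = p c\<close>. Then \<open>u / p = u c / D^Q\<close>, and \<open>k\<close>
  sections turn the denominator into \<open>D\<close>, remove the pole at \<open>0\<close> and bring the degree down to at
  most \<open>0\<close>.\<close>

lemma cartier_funpow_periodic:
  fixes p u :: "'a::{field,finite} poly"
  assumes l: "l > 0" and p: "p dvd frob_poly l ^ m" "degree p \<le> m"
    and u: "degree u \<le> m" and k: "m < CARD('a) ^ k"
  shows "(cartier p ^^ (l + k)) u = (cartier p ^^ k) u"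
proof -
  define Q where "Q = CARD('a) ^ k"
  define M where "M = CARD('a) ^ l"
  define D :: "'a poly" where "D = frob_poly l"
  have D0: "D \<noteq> 0" unfolding D_def by (rule frob_poly_nonzero[OF l])
  have Q: "Q > m" "Q > 0" using k by (simp_all add: Q_def)
  have "p dvd D ^ Q"
    using p(1) Q unfolding D_def by (meson dvd_trans le_imp_power_dvd less_imp_le)
  then obtain c where c: "D ^ Q = p * c" by auto
  with D0 have pc0: "p \<noteq> 0" "c \<noteq> 0" by (metis mult_zero_left mult_zero_right power_not_zero)+
  \<comment> \<open>\<open>D ^ Q\<close> vanishes at 0 to order at least \<open>Q\<close>, whereas
    \<open>p\<close> has order at most \<open>degree p \<le> m < Q\<close>. Hence the cofactor
    \<open>c\<close> vanishes at 0, and so does \<open>w\<close>.\<close>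
  have "[:0, 1:] dvd D"
    using l by (simp add: D_def frob_poly_def dvd_iff_poly_eq_0 poly_monom)
  then have "[:-0, 1:] ^ Q dvd p * c"
    unfolding c[symmetric] by (simp add: dvd_power_same)
  then have "Q \<le> order 0 (p * c)"
    using pc0 by (simp only: order_divides) simp
  also have "\<dots> = order 0 p + order 0 c"
    using pc0 by (intro order_mult) auto
  finally have "order 0 c > 0"
    using order_degree[OF pc0(1), of 0] Q p(2) by linarith
  then have c0: "coeff c 0 = 0"
    using order_root[of c 0] pc0 by (simp add: poly_0_coeff_0)
  have "degree p + degree c = Q * M"
    using c degree_mult_eq[OF pc0] degree_power_eq[OF D0, of Q] degree_frob_poly[OF l, where 'a = 'a]
    by (simp add: D_def M_def)
  then have deg_uc: "degree (u * c) \<le> Q * M + m"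
    using degree_mult_le[of u c] u by linarith
  define w where "w = (poly_section CARD('a) 0 ^^ k) (u * c)"
  have w0: "coeff w 0 = 0"
    by (simp add: w_def coeff_poly_section_funpow card_field_pos c0 coeff_mult)
  \<comment> \<open>The \<open>k\<close> sections divide exponents by \<open>Q\<close>, and
    \<open>Q * M + m < Q * (M + 1)\<close>.\<close>
  have "degree w \<le> M"
  proof (rule degree_le, intro allI impI)
    fix n assume "M < n"
    then have "Q * (M + 1) \<le> Q * n" by (intro mult_le_mono2) simp
    then have "degree (u * c) < Q * n" using deg_uc Q by simp
    then show "coeff w n = 0"
      by (simp add: w_def coeff_poly_section_funpow card_field_pos coeff_eq_0 flip: Q_def)
  qed
  then have per: "(cartier D ^^ l) w = w"
    unfolding D_def M_def by (intro cartier_frob_poly_funpow l w0)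
  have DQ: "D ^ Q = D * D ^ (Q - 1)"
    using Q by (metis power_eq_if less_not_refl)
  \<comment> \<open>After \<open>k\<close> steps the fraction is \<open>w / D\<close>, expanded by
    \<open>D ^ (Q - 1)\<close>.\<close>
  have "(cartier (D ^ Q) ^^ k) (u * c) = w * D ^ (Q - 1)"
  proof -
    have "(D ^ Q) ^ (Q - 1) = (D ^ (Q - 1)) ^ Q"
      by (simp add: mult.commute flip: power_mult)
    then show ?thesis
      unfolding cartier_funpow w_def Q_def by (simp add: poly_section_funpow_mult_power)
  qed
  moreover from this have "(cartier (D ^ Q) ^^ (l + k)) (u * c) = w * D ^ (Q - 1)"
    by (simp add: funpow_add DQ cartier_funpow_mult_both per)
  ultimately have "(cartier (p * c) ^^ (l + k)) (u * c) = (cartier (p * c) ^^ k) (u * c)"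
    by (simp add: c)
  then show ?thesis
    using pc0 by (simp add: cartier_funpow_mult_both)
qed

subsection \<open>Degrees of irreducible factors\<close>

lemma finite_polys_below: "finite {p :: 'a::{zero,finite} poly. \<forall>i\<ge>n. coeff p i = 0}"
  and card_polys_below: "card {p :: 'a::{zero,finite} poly. \<forall>i\<ge>n. coeff p i = 0} = CARD('a) ^ n"
proof -
  let ?A = "{p :: 'a poly. \<forall>i\<ge>n. coeff p i = 0}" and ?L = "{xs :: 'a list. set xs \<subseteq> UNIV \<and> length xs = n}"
  have bij: "bij_betw (\<lambda>p. map (coeff p) [0..<n]) ?A ?L"
  proof (rule bij_betw_byWitness[where f' = Poly])
    show "\<forall>p\<in>?A. Poly (map (coeff p) [0..<n]) = p"
      by (auto simp: poly_eq_iff nth_default_def not_less)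
    show "\<forall>xs\<in>?L. map (coeff (Poly xs)) [0..<n] = xs"
      by (auto simp: nth_default_def intro!: nth_equalityI)
  qed (auto simp: nth_default_def)
  have "finite ?L" by (rule finite_lists_length_eq) simp
  then show "finite ?A" using bij_betw_finite[OF bij] by simp
  have "card ?L = CARD('a) ^ n" by (rule card_lists_length_eq) simp
  then show "card ?A = CARD('a) ^ n" using bij_betw_same_card[OF bij] by simp
qed

text \<open>Lagrange's theorem for the multiplicative group of \<open>\<F>_q[X] / (p)\<close>, applied to the class of \<open>X\<close>.\<close>

lemma irreducible_dvd_frob_poly:
  fixes p :: "'a::{field,finite} poly"
  assumes irr: "irreducible p"
  shows "p dvd frob_poly (degree p)"
\<comment> \<open>If \<open>p\<close> divides \<open>X\<close>, the class of \<open>X\<close> is not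
  invertible, but then \<open>X\<close> itself divides \<open>frob_poly (degree p)\<close>.\<close>
proof (cases "p dvd monom 1 1")
  case True
  moreover have "monom 1 1 dvd (frob_poly (degree p) :: 'a poly)"
    using card_field_pos[where 'a = 'a]
    by (auto simp: frob_poly_def monom_1_dvd_iff' coeff_diff)
  ultimately show ?thesis by (rule dvd_trans)
next
  case False
  let ?n = "degree p" and ?X = "monom 1 1 :: 'a poly"
  have prime: "prime_elem p" by (rule field_poly_irreducible_imp_prime[OF irr])
  have p0: "p \<noteq> 0" using irr by auto
  have n: "?n > 0"
    using irr p0 by (metis irreducible_def is_unit_iff_degree neq0_conv)
  define A where "A = {r :: 'a poly. \<forall>i\<ge>?n. coeff r i = 0}"
  define R where "R = A - {0}"
  have A_iff: "r \<in> A \<longleftrightarrow> r = 0 \<or> degree r < ?n" for r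
    unfolding A_def using n by (auto simp: coeff_eq_0 intro!: coeff_0_degree_minus_1) (metis leading_coeff_0_iff not_le)
  have finA: "finite A" unfolding A_def by (rule finite_polys_below)
  have cardR: "card R = CARD('a) ^ ?n - 1"
    using finA card_polys_below[of ?n, where 'a = 'a]
    by (simp add: R_def A_iff card_Diff_singleton flip: A_def)
  have ndvd: "\<not> p dvd r" if "r \<in> R" for r
    using that dvd_imp_degree_le[of p r] by (auto simp: R_def A_iff)
  define f where "f = (\<lambda>r. (?X * r) mod p)"
  have inj: "inj_on f R"
  proof (rule inj_onI)
    fix r s assume rs: "r \<in> R" "s \<in> R" "f r = f s"
    then have "p dvd ?X * (r - s)"
      by (simp add: f_def mod_eq_dvd_iff algebra_simps)
    with prime False have "p dvd r - s" by (simp add: prime_elem_dvd_mult_iff)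
    moreover have "r - s \<in> A" using rs by (auto simp: R_def A_def)
    ultimately show "r = s" using ndvd[of "r - s"] by (auto simp: R_def)
  qed
  have img: "f ` R \<subseteq> R"
  proof
    fix s assume "s \<in> f ` R"
    then obtain r where r: "r \<in> R" "s = (?X * r) mod p" by (auto simp: f_def)
    have "s \<noteq> 0"
      using r False ndvd prime by (auto simp: mod_eq_0_iff_dvd prime_elem_dvd_mult_iff)
    moreover have "s = 0 \<or> degree s < ?n"
      using r degree_mod_less[OF p0, of "?X * r"] by simp
    ultimately show "s \<in> R" by (simp add: R_def A_iff)
  qed
  have "f ` R = R"
    by (rule endo_inj_surj) (use finA img inj in \<open>auto simp: R_def\<close>)
  then have "\<Prod>R = (\<Prod>r\<in>R. f r)"
    using prod.reindex[OF inj, of "\<lambda>x. x"] by simp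
  then have "\<Prod>R mod p = (\<Prod>r\<in>R. ?X * r) mod p"
    by (simp add: f_def mod_prod_eq)
  also have "(\<Prod>r\<in>R. ?X * r) = ?X ^ (CARD('a) ^ ?n - 1) * \<Prod>R"
    by (simp add: prod.distrib cardR)
  finally have "p dvd ?X ^ (CARD('a) ^ ?n - 1) * \<Prod>R - \<Prod>R"
    by (metis mod_eq_dvd_iff)
  also have "\<dots> = (?X ^ (CARD('a) ^ ?n - 1) - 1) * \<Prod>R"
    by (simp add: algebra_simps)
  finally have "p dvd ?X ^ (CARD('a) ^ ?n - 1) - 1 \<or> p dvd \<Prod>R"
    using prime by (simp add: prime_elem_dvd_mult_iff)
  moreover have "\<not> p dvd \<Prod>R"
  proof -
    have "finite S \<Longrightarrow> S \<subseteq> R \<Longrightarrow> \<not> p dvd \<Prod>S" for S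
    proof (induction S rule: finite_induct)
      case empty
      then show ?case using prime by (auto dest: prime_elem_not_unit)
    next
      case (insert x S)
      then show ?case using prime ndvd by (auto simp: prime_elem_dvd_mult_iff)
    qed
    then show ?thesis using finA by (simp add: R_def)
  qed
  ultimately have "p dvd ?X * (?X ^ (CARD('a) ^ ?n - 1) - 1)" by auto
  also have "\<dots> = frob_poly ?n"
    using card_field_pos[where 'a = 'a]
    by (simp add: frob_poly_def power_monom_1 algebra_simps mult_monom)
  finally show ?thesis .
qed

section \<open>Partitions formed by the degrees of irreducible factors\<close>

lemma parts_add: "\<sigma> \<in> parts m \<Longrightarrow> \<tau> \<in> parts n \<Longrightarrow> \<sigma> + \<tau> \<in> parts (m + n)"
  by (auto simp: parts_def)

text \<open>The partition lists the degrees of the irreducible factors with multiplicity; a unit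
  gets the empty partition.\<close>

lemma dvd_prod_frob_poly:
  fixes p :: "'a::{field,finite} poly"
  assumes "p \<noteq> 0"
  shows "\<exists>\<sigma>\<in>parts (degree p). p dvd (\<Prod>n\<in>#\<sigma>. frob_poly n)"
  using assms
proof (induction "degree p" arbitrary: p rule: less_induct)
  case less
  show ?case
  proof (cases "degree p = 0")
    case True
    then show ?thesis
      using less.prems by (intro bexI[of _ "{#}"]) (auto simp: parts_def is_unit_iff_degree)
  next
    case nonconst: False
    show ?thesis
    proof (cases "irreducible p")
      case True
      then show ?thesis
        using nonconst irreducible_dvd_frob_poly[OF True]
        by (intro bexI[of _ "{#degree p#}"]) (auto simp: parts_def)
    next
      case False
      then obtain a b where ab: "p = a * b" "\<not> is_unit a" "\<not> is_unit b"
        using nonconst less.prems by (auto simp: irreducible_def is_unit_iff_degree)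
      then have nz: "a \<noteq> 0" "b \<noteq> 0" using less.prems by auto
      then have deg: "degree a > 0" "degree b > 0" "degree p = degree a + degree b"
        using ab by (auto simp: is_unit_iff_degree degree_mult_eq)
      obtain \<sigma> where "\<sigma> \<in> parts (degree a)" "a dvd (\<Prod>n\<in>#\<sigma>. frob_poly n)"
        using less.hyps[of a] deg nz by auto
      moreover obtain \<tau> where "\<tau> \<in> parts (degree b)" "b dvd (\<Prod>n\<in>#\<tau>. frob_poly n)"
        using less.hyps[of b] deg nz by auto
      ultimately show ?thesis
        using ab deg by (intro bexI[of _ "\<sigma> + \<tau>"]) (auto simp: parts_add mult_dvd_mono)
    qed
  qed
qed

lemma size_le_parts: "\<sigma> \<in> parts n \<Longrightarrow> size \<sigma> \<le> n"
proof -
  have "0 \<notin># \<sigma> \<Longrightarrow> size \<sigma> \<le> sum_mset \<sigma>" for \<sigma> :: "nat multiset"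
    by (induction \<sigma>) auto
  then show "\<sigma> \<in> parts n \<Longrightarrow> size \<sigma> \<le> n" by (auto simp: parts_def)
qed

text \<open>At most \<open>m\<close> factors \<open>frob_poly n\<close> occur, and each divides
  \<open>frob_poly l\<close>. Allowing every multiple \<open>l\<close> of the lcm lets several
  polynomials share one \<open>l\<close>.\<close>

lemma dvd_power_frob_poly:
  fixes p :: "'a::{field,finite} poly"
  assumes "p \<noteq> 0" "degree p \<le> m" "m > 0"
  shows "\<exists>i\<in>{1..m}. \<exists>\<sigma>\<in>parts i. \<forall>l. partition_lcm \<sigma> dvd l \<longrightarrow> p dvd frob_poly l ^ m"
proof (cases "degree p = 0")
  \<comment> \<open>The maximum in \<open>landau_lcm\<close> runs over partitions of positive
    numbers only, so a constant \<open>p\<close> gets the partition of 1, whose lcm is 1.\<close>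
  case True
  then have "\<forall>l. p dvd frob_poly l ^ m"
    using assms by (metis is_unit_iff_degree unit_imp_dvd)
  then show ?thesis
    using assms(3) by (intro bexI[of _ 1] bexI[of _ "{#1#}"]) (auto simp: parts_def)
next
  case False
  obtain \<sigma> where \<sigma>: "\<sigma> \<in> parts (degree p)" "p dvd (\<Prod>n\<in>#\<sigma>. frob_poly n)"
    using dvd_prod_frob_poly[OF assms(1)] by auto
  have "p dvd frob_poly l ^ m" if l: "partition_lcm \<sigma> dvd l" for l
  proof -
    have "(\<Prod>n\<in>#\<tau>. frob_poly n :: 'a poly) dvd frob_poly l ^ size \<tau>" if "\<tau> \<subseteq># \<sigma>" for \<tau>
      using that
    proof (induction \<tau>)
      case (add x \<tau>)
      have "x \<in># \<sigma>" using add.prems by (meson insert_subset_eq_iff)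
      then have "x dvd l" using l by (auto simp: partition_lcm_def intro: dvd_trans dvd_Lcm)
      moreover have "\<tau> \<subseteq># \<sigma>"
        by (rule subset_mset.order_trans[OF _ add.prems]) simp
      ultimately show ?case
        using add.IH by (auto intro: mult_dvd_mono frob_poly_dvd)
    qed simp
    then have "p dvd frob_poly l ^ size \<sigma>" using \<sigma>(2) dvd_trans by blast
    moreover have "size \<sigma> \<le> m" using size_le_parts[OF \<sigma>(1)] assms(2) by simp
    ultimately show ?thesis by (meson dvd_trans le_imp_power_dvd)
  qed
  then show ?thesis
    using False assms(2) \<sigma>(1) by (intro bexI[of _ "degree p"] bexI[of _ \<sigma>]) auto
qed

lemma partition_lcm_dvd_fact:
  assumes "\<sigma> \<in> parts i" "i \<le> m"
  shows "partition_lcm \<sigma> dvd fact m"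
  unfolding partition_lcm_def
proof (rule Lcm_least)
  fix x assume "x \<in># \<sigma>"
  then have "x \<noteq> 0" "x \<le> i"
    using assms by (auto simp: parts_def dest: multi_member_split)
  then show "x dvd fact m" using assms(2) by (intro dvd_fact) auto
qed

lemma lcm_le_landau_lcm:
  assumes "i \<in> {1..l}" "j \<in> {1..m}" "k \<in> {1..n}"
    and "\<sigma>\<^sub>1 \<in> parts i" "\<sigma>\<^sub>2 \<in> parts j" "\<sigma>\<^sub>3 \<in> parts k"
  shows "lcm (lcm (partition_lcm \<sigma>\<^sub>1) (partition_lcm \<sigma>\<^sub>2)) (partition_lcm \<sigma>\<^sub>3) \<le> landau_lcm l m n"
  unfolding landau_lcm_def
proof (rule Max_ge)
  let ?S = "{lcm (lcm (partition_lcm \<sigma>\<^sub>1) (partition_lcm \<sigma>\<^sub>2)) (partition_lcm \<sigma>\<^sub>3)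
          | i j k \<sigma>\<^sub>1 \<sigma>\<^sub>2 \<sigma>\<^sub>3.
            i \<in> {1..l} \<and> j \<in> {1..m} \<and> k \<in> {1..n} \<and>
            \<sigma>\<^sub>1 \<in> parts i \<and> \<sigma>\<^sub>2 \<in> parts j \<and> \<sigma>\<^sub>3 \<in> parts k}"
  \<comment> \<open>\<open>Max\<close> requires a finite set; divisors of a fixed positive number
    provide one.\<close>
  have "?S \<subseteq> {x. x dvd lcm (lcm (fact l) (fact m)) (fact n)}"
    by (auto intro!: lcm_mono partition_lcm_dvd_fact)
  moreover have "finite {x. x dvd lcm (lcm (fact l) (fact m)) (fact n :: nat)}"
    by (rule finite_divisors_nat) (simp add: lcm_pos_nat)
  ultimately show "finite ?S" by (rule finite_subset)
qed (use assms in blast)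

lemma partition_lcm_pos: "\<sigma> \<in> parts i \<Longrightarrow> partition_lcm \<sigma> > 0"
  using partition_lcm_dvd_fact[of \<sigma> i i] by (metis dvd_0_left_iff fact_nonzero le_refl neq0_conv)

subsection \<open>Coefficientwise maps and degree bounds\<close>

lemma map_poly_mult_hom:
  fixes f :: "'a::comm_semiring_0 \<Rightarrow> 'b::comm_semiring_0"
  assumes "f 0 = 0" "\<And>x y. f (x + y) = f x + f y" "\<And>x y. f (x * y) = f x * f y"
  shows "map_poly f (p * q) = map_poly f p * map_poly f q"
proof (rule poly_eqI)
  fix n
  have "f (sum g A) = (\<Sum>i\<in>A. f (g i))" for g :: "nat \<Rightarrow> 'a" and A
    using assms(1,2) by (induction A rule: infinite_finite_induct) auto
  then show "coeff (map_poly f (p * q)) n = coeff (map_poly f p * map_poly f q) n"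
    by (simp add: coeff_map_poly coeff_mult assms)
qed

abbreviation fps_poly :: "'a::comm_ring_1 poly poly \<Rightarrow> 'a fps poly" where
  "fps_poly \<equiv> map_poly fps_of_poly"

lemma fps_poly_mult: "fps_poly (A * B) = fps_poly A * fps_poly B"
  by (rule map_poly_mult_hom) (simp_all add: fps_of_poly_add fps_of_poly_mult)

lemma fps_poly_power: "fps_poly (A ^ n) = fps_poly A ^ n"
  by (induction n) (simp_all add: fps_poly_mult)

lemma fps_poly_diff: "fps_poly (A - B) = fps_poly A - fps_poly B"
  by (rule poly_eqI) (simp add: coeff_map_poly fps_of_poly_diff)

lemma fps_of_poly_of_nat: "fps_of_poly (of_nat n) = of_nat n"
  by (induction n) (simp_all add: fps_of_poly_add)

lemma fps_poly_pderiv: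
  fixes A :: "'a::field poly poly"
  shows "fps_poly (pderiv A) = pderiv (fps_poly A)"
  by (rule poly_eqI)
    (simp add: coeff_map_poly coeff_pderiv fps_of_poly_mult fps_of_poly_of_nat fps_of_poly_add)

lemma poly_sum_upto:
  fixes p :: "'a::comm_semiring_1 poly"
  assumes "degree p \<le> n"
  shows "poly p x = (\<Sum>i\<le>n. coeff p i * x ^ i)"
  unfolding poly_altdef using assms
  by (intro sum.mono_neutral_left) (auto simp: coeff_eq_0)

text \<open>With bounds in place of exact degrees the identity also covers vanishing top
  coefficients.\<close>

lemma coeff_mult_top:
  fixes p q :: "'a::comm_semiring_0 poly"
  assumes "degree p \<le> m" "degree q \<le> n"
  shows "coeff (p * q) (m + n) = coeff p m * coeff q n"
proof -
  have "coeff (p * q) (m + n) = (\<Sum>i\<le>m + n. coeff p i * coeff q (m + n - i))"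
    by (rule coeff_mult)
  also have "\<dots> = (\<Sum>i\<in>{m}. coeff p i * coeff q (m + n - i))"
  proof (intro sum.mono_neutral_right ballI)
    fix i assume "i \<in> {..m + n} - {m}"
    then consider "i > m" | "m + n - i > n" by fastforce
    then show "coeff p i * coeff q (m + n - i) = 0"
      using assms by cases (auto simp: coeff_eq_0)
  qed auto
  finally show ?thesis by simp
qed

lemma degree_power_le_mult:
  "degree p \<le> m \<Longrightarrow> degree (p ^ n) \<le> n * m" for p :: "'a::comm_semiring_1 poly"
  using degree_power_le[of p n] by (metis le_trans mult.commute mult_le_mono2)

lemma coeff_power_top:
  fixes p :: "'a::comm_semiring_1 poly"
  assumes "degree p \<le> m"
  shows "coeff (p ^ n) (n * m) = coeff p m ^ n"
proof (induction n)
  case (Suc n)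
  then show ?case
    using coeff_mult_top[OF assms degree_power_le_mult[OF assms, of n]] by simp
qed simp

section \<open>Degree in \<open>x\<close> and the extreme columns of a bivariate polynomial\<close>

definition degree_x_le :: "'a::zero poly poly \<Rightarrow> nat \<Rightarrow> bool" where
  "degree_x_le A m \<longleftrightarrow> (\<forall>j. degree (coeff A j) \<le> m)"

lemma degree_x_le_mult:
  fixes A B :: "'a::comm_semiring_0 poly poly"
  assumes "degree_x_le A m" "degree_x_le B n"
  shows "degree_x_le (A * B) (m + n)"
  unfolding degree_x_le_def coeff_mult
proof (intro allI degree_sum_le)
  fix j i
  show "degree (coeff A i * coeff B (j - i)) \<le> m + n"
    using assms by (meson add_mono degree_mult_le degree_x_le_def order.trans)
qed simp

lemma degree_x_le_power:
  fixes A :: "'a::comm_semiring_1 poly poly"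
  assumes "degree_x_le A m"
  shows "degree_x_le (A ^ n) (n * m)"
proof (induction n)
  case 0
  show ?case by (auto simp: degree_x_le_def coeff_1)
next
  case (Suc n)
  then show ?case using degree_x_le_mult[OF assms] by simp
qed

definition x_coeff :: "nat \<Rightarrow> 'a::zero poly poly \<Rightarrow> 'a poly" where
  "x_coeff i = map_poly (\<lambda>p. coeff p i)"

lemma coeff_x_coeff [simp]: "coeff (x_coeff i A) j = coeff (coeff A j) i"
  by (simp add: x_coeff_def coeff_map_poly)

lemma x_coeff_0_mult:
  fixes A B :: "'a::comm_semiring_0 poly poly"
  shows "x_coeff 0 (A * B) = x_coeff 0 A * x_coeff 0 B"
  unfolding x_coeff_def by (rule map_poly_mult_hom) (simp_all add: coeff_mult)

lemma x_coeff_0_power: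
  fixes A :: "'a::comm_semiring_1 poly poly"
  shows "x_coeff 0 (A ^ n) = x_coeff 0 A ^ n"
proof (induction n)
  case 0
  show ?case by (rule poly_eqI) (simp add: coeff_1)
qed (simp add: x_coeff_0_mult)

lemma x_coeff_top_mult:
  fixes A B :: "'a::comm_semiring_0 poly poly"
  assumes "degree_x_le A m" "degree_x_le B n"
  shows "x_coeff (m + n) (A * B) = x_coeff m A * x_coeff n B"
  using assms by (intro poly_eqI)
    (simp add: coeff_mult[where ?'a = "'a poly"] coeff_mult[of "x_coeff m A"] coeff_sum
      coeff_mult_top degree_x_le_def del: coeff_mult)

lemma x_coeff_top_power:
  fixes A :: "'a::comm_semiring_1 poly poly"
  assumes "degree_x_le A m"
  shows "x_coeff (n * m) (A ^ n) = x_coeff m A ^ n"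
proof (induction n)
  case 0
  show ?case by (rule poly_eqI) (simp add: coeff_1)
next
  case (Suc n)
  then show ?case
    using x_coeff_top_mult[OF assms degree_x_le_power[OF assms, of n]] by simp
qed

subsection \<open>The Cartier operator on bivariate polynomials\<close>

text \<open>The residue \<open>q - 1\<close> in \<open>y\<close> is that of the Cartier operator on
  differential forms \<open>S / P dy\<close>, which is compatible with taking the residue at
  \<open>y = F\<close>.\<close>

definition cartier2 :: "'a::{field,finite} poly poly \<Rightarrow> nat \<Rightarrow> 'a poly poly \<Rightarrow> 'a poly poly" where
  "cartier2 P r S =
     map_poly (poly_section CARD('a) r) (poly_section CARD('a) (CARD('a) - 1) (S * P ^ (CARD('a) - 1)))"

lemma coeff_cartier2:
  fixes P S :: "'a::{field,finite} poly poly"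
  shows "coeff (cartier2 P r S) j =
    poly_section CARD('a) r (coeff (S * P ^ (CARD('a) - 1)) (CARD('a) * j + (CARD('a) - 1)))"
  by (simp add: cartier2_def coeff_map_poly card_field_pos)

text \<open>The functional which sends \<open>(y - F)^(q - 1) B + (y - F)^q C\<close> to \<open>B(F)\<close>.\<close>

definition top_digit :: "'a::{field,finite} fps \<Rightarrow> 'a fps poly \<Rightarrow> 'a fps" where
  "top_digit F A = poly (poly_section CARD('a) (CARD('a) - 1) A) (F ^ CARD('a))"

lemma top_digit_add: "top_digit F (A + B) = top_digit F A + top_digit F B"
proof -
  have "poly_section CARD('a) (CARD('a) - 1) (A + B)
      = poly_section CARD('a) (CARD('a) - 1) A + poly_section CARD('a) (CARD('a) - 1) B"
    by (rule poly_eqI) (simp add: card_field_pos)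
  then show ?thesis by (simp add: top_digit_def)
qed

lemma top_digit_smult: "top_digit F (smult c A) = c * top_digit F A"
  for A :: "'a::{field,finite} fps poly"
proof -
  have "poly_section CARD('a) (CARD('a) - 1) (smult c A)
      = smult c (poly_section CARD('a) (CARD('a) - 1) A)"
    by (rule poly_eqI) (simp add: card_field_pos)
  then show ?thesis by (simp add: top_digit_def)
qed

text \<open>The power is monic of degree \<open>q - 1\<close>, so among the exponents congruent to
  \<open>q - 1\<close> only the leading one occurs.\<close>

lemma top_digit_linear_power:
  fixes F :: "'a::{field,finite} fps"
  shows "top_digit F ([:-F, 1:] ^ (CARD('a) - 1)) = 1"
proof -
  let ?q = "CARD('a)" and ?L = "[:-F, 1:] ^ (CARD('a) - 1)"
  have deg: "degree ?L = ?q - 1" by (rule degree_linear_power)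
  have "lead_coeff ?L = 1" by (simp add: lead_coeff_power)
  have "coeff ?L (?q * n + (?q - 1)) = (if n = 0 then 1 else 0)" for n
  proof (cases "n = 0")
    case False
    then have "0 < ?q * n" using card_field_pos[where 'a = 'a] by simp
    then have "degree ?L < ?q * n + (?q - 1)" unfolding deg by linarith
    then show ?thesis using False by (simp only: coeff_eq_0 if_False)
  qed (use deg \<open>lead_coeff ?L = 1\<close> in simp)
  then have "poly_section ?q (?q - 1) ?L = 1"
    by (intro poly_eqI) (simp add: card_field_pos coeff_1)
  then show ?thesis by (simp add: top_digit_def)
qed

text \<open>By Frobenius \<open>(y - F)^q = y^q - F^q\<close>. The section turns the factor
  \<open>y^q\<close> into \<open>y\<close>, which is evaluated at \<open>F^q\<close>, so the two
  terms cancel.\<close>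

lemma top_digit_mult_linear_power:
  fixes F :: "'a::{field,finite} fps"
  shows "top_digit F (A * [:-F, 1:] ^ CARD('a)) = 0"
proof -
  let ?q = "CARD('a)"
  have q: "?q > 0" by (rule card_field_pos)
  have "[:-F, 1:] = monom 1 1 - [:F:]" by (simp add: monom_altdef)
  then have L: "[:-F, 1:] ^ ?q = monom 1 ?q - [:F ^ ?q:]"
    by (simp only: frobenius_diff_fps_poly power_monom_1 poly_const_pow mult_1)
  have e: "A * [:-F, 1:] ^ ?q = monom 1 ?q * A - smult (F ^ ?q) A"
    unfolding L right_diff_distrib by (simp add: mult.commute)
  have "poly_section ?q (?q - 1) (A * [:-F, 1:] ^ ?q)
      = pCons 0 (poly_section ?q (?q - 1) A) - smult (F ^ ?q) (poly_section ?q (?q - 1) A)"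
  proof (rule poly_eqI)
    fix n
    have "coeff (monom 1 ?q * A) (?q * n + (?q - 1)) = coeff (pCons 0 (poly_section ?q (?q - 1) A)) n"
    proof (cases n)
      case 0
      then show ?thesis using q by (simp add: coeff_monom_mult)
    next
      case (Suc m)
      then have "?q * n + (?q - 1) = ?q + (?q * m + (?q - 1))" by simp
      then show ?thesis using Suc q by (simp add: coeff_monom_mult)
    qed
    then show "coeff (poly_section ?q (?q - 1) (A * [:-F, 1:] ^ ?q)) n
        = coeff (pCons 0 (poly_section ?q (?q - 1) A) - smult (F ^ ?q) (poly_section ?q (?q - 1) A)) n"
      using q by (simp add: e)
  qed
  then show ?thesis by (simp add: top_digit_def)
qed

text \<open>Division by \<open>y - F\<close> gives \<open>B = (y - F) C + B(F)\<close>; after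
  multiplication by \<open>(y - F)^(q - 1)\<close> the two previous lemmas evaluate the
  summands.\<close>

lemma top_digit_eq:
  fixes F :: "'a::{field,finite} fps"
  shows "top_digit F ([:-F, 1:] ^ (CARD('a) - 1) * B) = poly B F"
proof -
  let ?q = "CARD('a)" and ?L = "[:-F, 1:]" and ?C = "synthetic_div B F"
  have 1: "?L * ?L ^ (?q - 1) = ?L ^ ?q"
    using card_field_pos[where 'a = 'a] by (metis power_minus_mult mult.commute)
  have 2: "M * (N * C + [:b:]) = C * (N * M) + smult b M" for M N C :: "'a fps poly" and b
    by (simp add: distrib_left mult.commute[of M "[:b:]"] mult_ac)
  have "?L ^ (?q - 1) * (?L * ?C + [:poly B F:]) = ?C * ?L ^ ?q + smult (poly B F) (?L ^ (?q - 1))"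
    by (simp only: 2 1)
  then show ?thesis
    unfolding synthetic_div_correct'
    by (simp only: top_digit_add top_digit_smult top_digit_linear_power top_digit_mult_linear_power) simp
qed

section \<open>Residue series at \<open>y = F\<close> and their sections\<close>

definition residue_series :: "'a::{field,finite} poly poly \<Rightarrow> 'a fps \<Rightarrow> 'a poly poly \<Rightarrow> 'a fps" where
  "residue_series P F S = poly (fps_poly S) F * inverse (poly (fps_poly (pderiv P)) F)"

lemma poly_fps_nth_0:
  assumes "fps_nth F 0 = 0"
  shows "fps_nth (poly (fps_poly A) F) 0 = poly (poly A 0) 0"
  using assms by (cases A) (simp add: map_poly_pCons poly_0_coeff_0)

lemma residue_series_section:
  fixes P S :: "'a::{field,finite} poly poly"
  assumes P: "furstenberg_poly P" and F: "furstenberg_series P F" and r: "r < CARD('a)"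
  shows "fps_section CARD('a) r (residue_series P F S) = residue_series P F (cartier2 P r S)"
proof -
  let ?q = "CARD('a)"
  have q: "?q > 0" by (rule card_field_pos)
  define U where "U = poly (fps_poly (pderiv P)) F"
  have U0: "fps_nth U 0 \<noteq> 0"
    using P F by (simp add: U_def poly_fps_nth_0 furstenberg_series_def furstenberg_poly_def)
  have "[:-F, 1:] dvd fps_poly P"
    using F by (simp add: furstenberg_series_def poly_eq_0_iff_dvd)
  then obtain R where R: "fps_poly P = [:-F, 1:] * R" by auto
  \<comment> \<open>The product rule at the root \<open>F\<close> of \<open>fps_poly P\<close> kills
    the term with the derivative of \<open>R\<close>.\<close>
  have UR: "U = poly R F"
    unfolding U_def fps_poly_pderiv R pderiv_mult by (simp add: pderiv_pCons)
  define A where "A = S * P ^ (?q - 1)"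
  define T where "T = poly_section ?q (?q - 1) (fps_poly A)"
  have "fps_poly A = [:-F, 1:] ^ (?q - 1) * (fps_poly S * R ^ (?q - 1))"
    by (simp only: A_def fps_poly_mult fps_poly_power R power_mult_distrib mult.left_commute)
  then have "top_digit F (fps_poly A) = poly (fps_poly S) F * U ^ (?q - 1)"
    by (simp only: top_digit_eq) (simp add: UR)
  then have T: "poly T (F ^ ?q) = poly (fps_poly S) F * U ^ (?q - 1)"
    by (simp add: top_digit_def T_def)
  have "U ^ (?q - 1) * inverse U ^ ?q = inverse U"
  proof -
    have 1: "inverse U ^ ?q = inverse U ^ (?q - 1) * inverse U"
      by (rule power_minus_mult[OF q, symmetric])
    have 2: "U ^ (?q - 1) * inverse U ^ (?q - 1) = 1"
      using inverse_mult_eq_1[OF U0] by (simp add: mult.commute flip: power_mult_distrib)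
    show ?thesis by (simp only: 1 2 mult.assoc[symmetric] mult_1)
  qed
  \<comment> \<open>Expanding \<open>S(F) / U\<close> by \<open>U ^ (q - 1)\<close> gives a
    denominator \<open>U ^ q\<close> and a numerator that is a polynomial in
    \<open>F ^ q\<close>.\<close>
  then have "residue_series P F S = poly T (F ^ ?q) * inverse U ^ ?q"
    by (simp add: residue_series_def T mult.assoc flip: U_def)
  then have "fps_section ?q r (residue_series P F S) = fps_section ?q r (poly T (F ^ ?q)) * inverse U"
    by (simp add: fps_section_mult_power r)
  \<comment> \<open>Each \<open>(F ^ i) ^ q\<close> leaves the section as \<open>F ^ i\<close>, and
    the sections of the coefficients of \<open>T\<close> are those of
    \<open>cartier2 P r S\<close>.\<close>
  also have "fps_section ?q r (poly T (F ^ ?q)) = poly (fps_poly (cartier2 P r S)) F"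
  proof -
    let ?C = "fps_poly (cartier2 P r S)"
    define n where "n = max (degree T) (degree ?C)"
    have T_coeff: "coeff T i = fps_of_poly (coeff A (?q * i + (?q - 1)))" for i
      using q by (simp add: T_def coeff_map_poly)
    have C_coeff: "coeff ?C i = fps_section ?q r (coeff T i)" for i
      using q by (simp add: coeff_map_poly coeff_cartier2 fps_section_of_poly T_coeff A_def)
    have "fps_section ?q r (poly T (F ^ ?q)) = (\<Sum>i\<le>n. fps_section ?q r (coeff T i * (F ^ i) ^ ?q))"
      by (subst poly_sum_upto[where n = n])
        (simp_all add: n_def fps_section_sum mult.commute flip: power_mult)
    also have "\<dots> = poly ?C F"
      by (subst poly_sum_upto[where n = n])
        (simp_all add: n_def fps_section_mult_power r C_coeff)
    finally show ?thesis .
  qed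
  finally show ?thesis by (simp add: residue_series_def U_def)
qed

text \<open>Multiples of \<open>P\<close> vanish at \<open>y = F\<close>, so only
  \<open>y P\<^sub>y\<close> matters for the series; the multiple \<open>d P\<close> is chosen to
  cancel the coefficient of \<open>y^d\<close>.\<close>

definition initial_poly :: "'a::{field,finite} poly poly \<Rightarrow> 'a poly poly" where
  "initial_poly P = pCons 0 (pderiv P) - smult (of_nat (degree P)) P"

lemma residue_series_initial:
  fixes P :: "'a::{field,finite} poly poly"
  assumes P: "furstenberg_poly P" and F: "furstenberg_series P F"
  shows "residue_series P F (initial_poly P) = F"
proof -
  define U where "U = poly (fps_poly (pderiv P)) F"
  have U0: "fps_nth U 0 \<noteq> 0"
    using P F by (simp add: U_def poly_fps_nth_0 furstenberg_series_def furstenberg_poly_def)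
  have "fps_poly (smult c P) = smult (fps_of_poly c) (fps_poly P)" for c
    by (rule poly_eqI) (simp add: coeff_map_poly fps_of_poly_mult)
  then have "poly (fps_poly (initial_poly P)) F = F * U"
    using F by (simp add: initial_poly_def fps_poly_diff map_poly_pCons U_def furstenberg_series_def)
  then show ?thesis
    using inverse_mult_eq_1[OF U0]
    by (simp add: residue_series_def mult.assoc mult.commute[of U] flip: U_def)
qed

section \<open>Degree bounds for the initial polynomial and its successors\<close>

lemma degree_initial_poly:
  fixes P :: "'a::{field,finite} poly poly"
  assumes "degree P > 0"
  shows "degree (initial_poly P) \<le> degree P - 1"
proof (rule degree_le, intro allI impI)
  fix i assume i: "degree P - 1 < i"
  then obtain j where j: "i = Suc j" by (cases i) auto
  show "coeff (initial_poly P) i = 0"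
  proof (cases "i = degree P")
    case True
    then have "degree P = Suc j" by (simp add: j)
    then show ?thesis by (simp add: initial_poly_def j coeff_pderiv)
  next
    case False
    then have "coeff P i = 0" using i by (intro coeff_eq_0) simp
    then show ?thesis by (simp add: initial_poly_def j coeff_pderiv)
  qed
qed

lemma degree_x_le_initial_poly:
  fixes P :: "'a::{field,finite} poly poly"
  assumes "degree_x_le P m"
  shows "degree_x_le (initial_poly P) m"
  unfolding degree_x_le_def
proof
  fix j
  have of_nat: "degree (of_nat n * p) \<le> degree p" for n and p :: "'a poly"
    by (metis degree_mult_le degree_of_nat add_0)
  have "coeff (initial_poly P) j = of_nat j * coeff P j - of_nat (degree P) * coeff P j"
    by (cases j) (auto simp: initial_poly_def coeff_pderiv)
  also have "degree \<dots> \<le> m"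
    using assms of_nat unfolding degree_x_le_def by (meson degree_diff_le order.trans)
  finally show "degree (coeff (initial_poly P) j) \<le> m" .
qed

text \<open>The product has degree at most \<open>(d - 1) + (q - 1) * d = q * d - 1\<close> in
  \<open>y\<close>, so no exponent \<open>q * j + (q - 1)\<close> with \<open>j \<ge> d\<close>
  occurs.\<close>

lemma degree_cartier2:
  fixes P S :: "'a::{field,finite} poly poly"
  assumes "degree P \<le> d" "degree S \<le> d - 1" "d > 0"
  shows "degree (cartier2 P r S) \<le> d - 1"
proof (rule degree_le, intro allI impI)
  let ?q = "CARD('a)"
  have q: "?q > 0" by (rule card_field_pos)
  fix j assume "d - 1 < j"
  then have "?q * d \<le> ?q * j" using assms(3) by (intro mult_le_mono2) simp
  moreover have "degree (S * P ^ (?q - 1)) \<le> (d - 1) + (?q - 1) * d"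
    using degree_mult_le[of S "P ^ (?q - 1)"] degree_power_le_mult[OF assms(1), of "?q - 1"] assms(2)
    by linarith
  moreover have "(d - 1) + (?q - 1) * d + 1 = ?q * d"
    using q assms(3) by (cases ?q) auto
  ultimately have "coeff (S * P ^ (?q - 1)) (?q * j + (?q - 1)) = 0"
    by (intro coeff_eq_0) linarith
  then show "coeff (cartier2 P r S) j = 0"
    by (simp add: coeff_cartier2 card_field_pos)
qed

text \<open>The left side of the inequality bounds the degree of \<open>S * P ^ (q - 1)\<close> in
  \<open>x\<close>, and the right side is the first exponent that would contribute beyond
  \<open>x^n\<close>.\<close>

lemma degree_x_cartier2:
  fixes P S :: "'a::{field,finite} poly poly"
  assumes P: "degree_x_le P h" and S: "degree_x_le S m" and n: "m + (CARD('a) - 1) * h < CARD('a) * (n + 1) + r"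
  shows "degree_x_le (cartier2 P r S) n"
  unfolding degree_x_le_def
proof (intro allI degree_le impI)
  let ?q = "CARD('a)"
  fix j i assume "n < i"
  then have "?q * (n + 1) \<le> ?q * i" by (intro mult_le_mono2) simp
  moreover have "degree (coeff (S * P ^ (?q - 1)) (?q * j + (?q - 1))) \<le> m + (?q - 1) * h"
    using degree_x_le_mult[OF S degree_x_le_power[OF P]] unfolding degree_x_le_def by blast
  ultimately have "degree (coeff (S * P ^ (?q - 1)) (?q * j + (?q - 1))) < ?q * i + r"
    using n by linarith
  then show "coeff (coeff (cartier2 P r S) j) i = 0"
    by (simp add: coeff_cartier2 card_field_pos coeff_eq_0)
qed

section \<open>Autonomous evolution of the border coefficients\<close>

lemma cartier_pCons_0:
  fixes p u :: "'a::{field,finite} poly"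
  shows "cartier p (pCons 0 u) = pCons 0 (poly_section CARD('a) (CARD('a) - 1) (u * p ^ (CARD('a) - 1)))"
proof (rule poly_eqI)
  let ?q = "CARD('a)"
  have q: "?q > 0" by (rule card_field_pos)
  fix n
  show "coeff (cartier p (pCons 0 u)) n
      = coeff (pCons 0 (poly_section ?q (?q - 1) (u * p ^ (?q - 1)))) n"
  proof (cases n)
    case (Suc m)
    then have "?q * n = Suc (?q * m + (?q - 1))" using q by simp
    moreover have "coeff (cartier p (pCons 0 u)) n = coeff (pCons 0 (u * p ^ (?q - 1))) (?q * n)"
      by (simp add: cartier_def card_field_pos)
    ultimately have "coeff (cartier p (pCons 0 u)) n = coeff (u * p ^ (?q - 1)) (?q * m + (?q - 1))"
      by (simp only: coeff_pCons_Suc)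
    then show ?thesis using Suc q by simp
  qed (simp add: cartier_def card_field_pos)
qed

text \<open>Taking the coefficient of \<open>x^0\<close> is multiplicative, so this column of
  \<open>S * P ^ (q - 1)\<close> depends only on the same columns of \<open>S\<close> and
  \<open>P\<close>.\<close>

lemma x_coeff_0_cartier2:
  "pCons 0 (x_coeff 0 (cartier2 P 0 S)) = cartier (x_coeff 0 P) (pCons 0 (x_coeff 0 S))"
  unfolding cartier_pCons_0 x_coeff_0_power[symmetric] x_coeff_0_mult[symmetric]
  by (rule arg_cong[where f = "pCons 0"], rule poly_eqI) (simp add: coeff_cartier2 card_field_pos)

text \<open>The bounds add up to \<open>h + (q - 1) * h = q * h\<close>, the exponent that residue 0
  sends to \<open>h\<close>, and top columns multiply.\<close>

lemma x_coeff_top_cartier2: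
  fixes P S :: "'a::{field,finite} poly poly"
  assumes "degree_x_le P h" "degree_x_le S h"
  shows "pCons 0 (x_coeff h (cartier2 P 0 S)) = cartier (x_coeff h P) (pCons 0 (x_coeff h S))"
proof -
  have "h + (CARD('a) - 1) * h = CARD('a) * h"
    using card_field_pos[where 'a = 'a] by (cases "CARD('a)") auto
  then have "x_coeff h S * x_coeff h P ^ (CARD('a) - 1) = x_coeff (CARD('a) * h) (S * P ^ (CARD('a) - 1))"
    using x_coeff_top_mult[OF assms(2) degree_x_le_power[OF assms(1), of "CARD('a) - 1"]]
      x_coeff_top_power[OF assms(1), of "CARD('a) - 1"] by simp
  then show ?thesis
    unfolding cartier_pCons_0
    by (intro arg_cong[where f = "pCons 0"] poly_eqI) (simp add: coeff_cartier2 card_field_pos)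
qed

text \<open>Likewise in \<open>y\<close>: the largest possible exponent
  \<open>(d - 1) + (q - 1) * d\<close> is the one the section sends to \<open>d - 1\<close>.\<close>

lemma coeff_top_cartier2:
  fixes P S :: "'a::{field,finite} poly poly"
  assumes "degree P \<le> d" "degree S \<le> d - 1" "d > 0"
  shows "coeff (cartier2 P 0 S) (d - 1) = cartier (coeff P d) (coeff S (d - 1))"
proof -
  let ?q = "CARD('a)"
  have "(d - 1) + (?q - 1) * d = ?q * (d - 1) + (?q - 1)"
    using card_field_pos[where 'a = 'a] assms(3) by (cases d; cases ?q) auto
  then have "coeff (S * P ^ (?q - 1)) (?q * (d - 1) + (?q - 1)) = coeff S (d - 1) * coeff P d ^ (?q - 1)"
    using coeff_mult_top[OF assms(2) degree_power_le_mult[OF assms(1), of "?q - 1"]]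
      coeff_power_top[OF assms(1), of "?q - 1"] by simp
  then show ?thesis by (simp add: coeff_cartier2 cartier_def)
qed

subsection \<open>Automata from finite sets of series closed under sections\<close>

definition digits_value :: "nat \<Rightarrow> nat list \<Rightarrow> nat" where
  "digits_value q w = foldr (\<lambda>c n. c + q * n) w 0"

lemma digits_value_simps [simp]:
  "digits_value q [] = 0" "digits_value q (c # w) = c + q * digits_value q w"
  by (simp_all add: digits_value_def)

lemma digits_value_base_digits:
  assumes "q \<ge> 2"
  shows "digits_value q (base_digits q n @ replicate k 0) = n"
proof (induction n rule: less_induct)
  case (less n)
  have "digits_value q (replicate k 0) = 0" by (induction k) auto
  then show ?case
    using less[of "n div q"] assms by (subst base_digits.simps) auto
qed

lemma base_digits_less:
  assumes "q \<ge> 2"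
  shows "\<forall>c\<in>set (base_digits q n). c < q"
proof (induction n rule: less_induct)
  case (less n)
  show ?case
  proof (cases "n = 0")
    case False
    then have "base_digits q n = n mod q # base_digits q (n div q)"
      using assms by (simp add: base_digits.simps[of q n])
    moreover have "n div q < n" "n mod q < q" using False assms by simp_all
    ultimately show ?thesis using less by (metis set_ConsD)
  next
    case True
    then have "base_digits q n = []" by (subst base_digits.simps) simp
    then show ?thesis by simp
  qed
qed

lemma fps_nth_0_foldl_section:
  "fps_nth (foldl (\<lambda>G c. fps_section q c G) F w) 0 = fps_nth F (digits_value q w)"
proof -
  \<comment> \<open>The induction needs all coefficients: a further digit is read at the position
    \<open>q ^ length w\<close>.\<close>
  have "fps_nth (foldl (\<lambda>G c. fps_section q c G) F w) n
      = fps_nth F (digits_value q w + q ^ length w * n)" for n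
    by (induction w arbitrary: F) (simp_all add: algebra_simps)
  from this[of 0] show ?thesis by simp
qed

text \<open>States number the series in \<open>X\<close>, a digit acts as its section, and the
  output is the constant coefficient. The result depends only on the value of the digit word, so
  leading zeros are harmless.\<close>

lemma admissible_automaton_exists:
  fixes F :: "'a::{field,finite} fps"
  assumes q: "q \<ge> 2" and X: "finite X" "F \<in> X"
    and closed: "\<And>G r. G \<in> X \<Longrightarrow> r < q \<Longrightarrow> fps_section q r G \<in> X"
  shows "\<exists>M. admissible_automaton q (fps_nth F) M \<and> card (states M) = card X"
proof -
  obtain f where f: "bij_betw f X {0..<card X}"
    using ex_bij_betw_finite_nat[OF X(1)] by blast
  define g where "g = inv_into X f"
  have gf: "g (f G) = G" if "G \<in> X" for G
    using f that by (simp add: g_def bij_betw_inv_into_left)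
  have g: "g s \<in> X" if "s \<in> {0..<card X}" for s
    using f that by (metis bij_betw_def g_def inv_into_into)
  have f_mem: "f G \<in> {0..<card X}" if "G \<in> X" for G
    using f that by (auto simp: bij_betw_def)
  define M where "M = \<lparr>states = {0..<card X}, initial = f F,
    trans_fun = (\<lambda>s c. f (fps_section q c (g s))), out_fun = (\<lambda>s. fps_nth (g s) 0)\<rparr>"
  have fold: "foldl (trans_fun M) (f G) w = f (foldl (\<lambda>G c. fps_section q c G) G w) \<and>
      foldl (\<lambda>G c. fps_section q c G) G w \<in> X"
    if "G \<in> X" "\<forall>c\<in>set w. c < q" for G w
    using that by (induction w arbitrary: G) (auto simp: M_def gf closed)
  have out: "output_on M (base_digits q n @ replicate k 0) = fps_nth F n" for n k
  proof -
    let ?w = "base_digits q n @ replicate k 0"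
    have "\<forall>c\<in>set ?w. c < q"
      using base_digits_less[OF q, of n] q by auto
    then have "foldl (trans_fun M) (f F) ?w = f (foldl (\<lambda>G c. fps_section q c G) F ?w)"
      and "foldl (\<lambda>G c. fps_section q c G) F ?w \<in> X"
      using fold[OF X(2)] by blast+
    then have "output_on M ?w = fps_nth (foldl (\<lambda>G c. fps_section q c G) F ?w) 0"
      by (simp add: output_on_def M_def gf del: foldl_append)
    then show ?thesis
      by (simp only: fps_nth_0_foldl_section digits_value_base_digits[OF q])
  qed
  have "q_automaton q M"
    using X f_mem g closed by (auto simp: q_automaton_def M_def simp del: atLeastLessThan_iff)
  moreover have "generates q M (fps_nth F)"
    using out[of _ 0] by (simp add: generates_def)
  moreover have "unaffected_by_leading_zeros q M (fps_nth F)"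
    using out by (simp add: unaffected_by_leading_zeros_def)
  ultimately show ?thesis
    by (intro exI[of _ M]) (simp add: admissible_automaton_def M_def)
qed

lemma minimal_automaton_exists:
  assumes "admissible_automaton q a M"
  shows "\<exists>M. minimal_automaton q a M"
  unfolding minimal_automaton_def
  by (rule ex_has_least_nat[where P = "admissible_automaton q a", OF assms])

subsection \<open>Counting\<close>

lemma finite_card_le_functions:
  fixes f :: "'s \<Rightarrow> 'i \<Rightarrow> 'b::finite"
  assumes "finite I" and inj: "\<And>S T. S \<in> X \<Longrightarrow> T \<in> X \<Longrightarrow> (\<And>i. i \<in> I \<Longrightarrow> f S i = f T i) \<Longrightarrow> S = T"
  shows "finite X" "card X \<le> CARD('b) ^ card I"
proof -
  let ?g = "\<lambda>S. restrict (f S) I"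
  have "inj_on ?g X"
    by (intro inj_onI inj) (metis restrict_apply')+
  moreover have "?g ` X \<subseteq> (\<Pi>\<^sub>E i\<in>I. UNIV)" by auto
  moreover have "finite (\<Pi>\<^sub>E i\<in>I. UNIV :: 'b set)"
    using assms(1) by (intro finite_PiE) auto
  moreover have "card (\<Pi>\<^sub>E i\<in>I. UNIV :: 'b set) = CARD('b) ^ card I"
    using assms(1) by (simp add: card_PiE)
  ultimately show "finite X" "card X \<le> CARD('b) ^ card I"
    using finite_imageD[of ?g X] finite_subset[of "?g ` X"] card_inj_on_le[of ?g X "\<Pi>\<^sub>E i\<in>I. UNIV"]
    by auto
qed

lemma poly_poly_eqI:
  fixes S T :: "'a::zero poly poly"
  assumes "degree S \<le> n" "degree T \<le> n" "degree_x_le S m" "degree_x_le T m"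
    and "\<And>i j. i \<le> m \<Longrightarrow> j \<le> n \<Longrightarrow> coeff (coeff S j) i = coeff (coeff T j) i"
  shows "S = T"
proof (intro poly_eqI)
  fix j i
  consider "i > m" | "j > n" | "i \<le> m" "j \<le> n" by linarith
  then show "coeff (coeff S j) i = coeff (coeff T j) i"
  proof cases
    case 1
    then have "degree (coeff S j) < i" "degree (coeff T j) < i"
      using assms(3,4) by (auto simp: degree_x_le_def intro: le_less_trans)
    then show ?thesis by (simp add: coeff_eq_0)
  qed (use assms in \<open>auto simp: coeff_eq_0\<close>)
qed

definition box :: "nat \<Rightarrow> nat \<Rightarrow> 'a::zero poly poly set" where
  "box m n = {S. degree S \<le> n \<and> degree_x_le S m}"

lemma finite_box: "finite (box m n :: 'a::{zero,finite} poly poly set)"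
  and card_box: "card (box m n :: 'a::{zero,finite} poly poly set) \<le> CARD('a) ^ ((m + 1) * (n + 1))"
proof -
  let ?f = "\<lambda>(S :: 'a poly poly) (i, j). coeff (coeff S j) i" and ?I = "{..m} \<times> {..n}"
  have "S = T" if "S \<in> box m n" "T \<in> box m n" "\<And>i. i \<in> ?I \<Longrightarrow> ?f S i = ?f T i" for S T
    using that by (intro poly_poly_eqI[of S n T m]) (auto simp: box_def)
  then show "finite (box m n :: 'a poly poly set)"
    "card (box m n :: 'a poly poly set) \<le> CARD('a) ^ ((m + 1) * (n + 1))"
    using finite_card_le_functions[of ?I "box m n" ?f] by auto
qed

text \<open>The columns are multiplied by \<open>y\<close> because this turns the section with residue \<open>q - 1\<close> into the
  one with residue \<open>0\<close>, so that all three components evolve by \<^const>\<open>cartier\<close>.\<close>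

definition border :: "nat \<Rightarrow> nat \<Rightarrow> 'a::zero poly poly \<Rightarrow> 'a poly \<times> 'a poly \<times> 'a poly" where
  "border m n S = (coeff S n, pCons 0 (x_coeff 0 S), pCons 0 (x_coeff m S))"

text \<open>Once the border is fixed, only the coefficients with \<open>0 < i < m\<close> and
  \<open>j < n\<close> remain free.\<close>

lemma card_box_border:
  fixes b :: "'a::{zero,finite} poly \<times> 'a poly \<times> 'a poly"
  shows "card {S \<in> box m n. border m n S = b} \<le> CARD('a) ^ ((m - 1) * n)"
proof -
  let ?f = "\<lambda>(S :: 'a poly poly) (i, j). coeff (coeff S j) i" and ?I = "{1..<m} \<times> {..<n}"
  have "S = T" if S: "S \<in> box m n" "border m n S = b" and T: "T \<in> box m n" "border m n T = b"
    and eq: "\<And>i. i \<in> ?I \<Longrightarrow> ?f S i = ?f T i" for S T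
  proof (rule poly_poly_eqI[of S n T m])
    fix i j assume "i \<le> m" "j \<le> n"
    then consider "j = n" | "i = 0" | "i = m" | "i \<in> {1..<m}" "j < n" by fastforce
    then show "coeff (coeff S j) i = coeff (coeff T j) i"
    proof cases
      case 1
      then show ?thesis using S T by (auto simp: border_def)
    next
      case 2
      have "x_coeff 0 S = x_coeff 0 T" using S T by (auto simp: border_def)
      then show ?thesis using 2 by (metis coeff_x_coeff)
    next
      case 3
      have "x_coeff m S = x_coeff m T" using S T by (auto simp: border_def)
      then show ?thesis using 3 by (metis coeff_x_coeff)
    next
      case 4
      then show ?thesis using eq[of "(i, j)"] by simp
    qed
  qed (use S T in \<open>auto simp: box_def\<close>)
  then show ?thesis
    using finite_card_le_functions(2)[of ?I "{S \<in> box m n. border m n S = b}" ?f] by auto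
qed

lemma funpow_eventually_periodic:
  fixes g :: "'b \<Rightarrow> 'b"
  assumes "(g ^^ (l + k)) x = (g ^^ k) x" "k \<le> e"
  shows "(g ^^ e) x = (g ^^ (k + (e - k) mod l)) x"
proof -
  have "(g ^^ ((e - k) mod l)) ((g ^^ k) x) = (g ^^ (e - k)) ((g ^^ k) x)"
    by (rule funpow_mod_eq) (use assms in \<open>simp add: funpow_add\<close>)
  then have "(g ^^ ((e - k) mod l + k)) x = (g ^^ (e - k + k)) x"
    by (simp add: funpow_add)
  then show ?thesis using assms(2) by (simp add: add.commute)
qed

subsection \<open>The bound\<close>

context
  fixes P :: "'a::{field,finite} poly poly" and F :: "'a fps" and h d :: nat
  assumes P: "furstenberg_poly P" and h: "h = degree_x P" and d: "d = degree P"
    and F: "furstenberg_series P F" and F0: "F \<noteq> 0"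
begin

lemma degree_x_le_P: "degree_x_le P h"
  unfolding degree_x_le_def
proof
  fix j
  show "degree (coeff P j) \<le> h"
  proof (cases "j \<le> degree P")
    case True
    then show ?thesis by (simp add: h degree_x_def)
  qed (simp add: coeff_eq_0)
qed

lemma coeff_0_1_P: "coeff (coeff P 1) 0 \<noteq> 0"
  using P by (simp add: furstenberg_poly_def poly_0_coeff_0 coeff_pderiv)

lemma d_pos: "d > 0"
  using coeff_0_1_P by (metis coeff_0 coeff_eq_0 d less_numeral_extra(1) neq0_conv)

lemma x_coeff_h_P: "x_coeff h P \<noteq> 0"
proof -
  have "h \<in> (\<lambda>i. degree (coeff P i)) ` {..degree P}"
    unfolding h degree_x_def by (intro Max_in) auto
  then obtain i where i: "degree (coeff P i) = h" by auto
  show ?thesis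
  proof (cases "coeff P i = 0")
    case True
    then have "h = 0" using i by simp
    then show ?thesis using coeff_0_1_P by (metis coeff_0 coeff_x_coeff)
  next
    case False
    then show ?thesis using i by (metis coeff_0 coeff_x_coeff leading_coeff_0_iff)
  qed
qed

text \<open>If \<open>h = 0\<close>, the coefficients of \<open>P\<close> are constants and
  \<open>P(0, 0) = 0\<close> gives \<open>P = y R\<close>. Then \<open>R(F)\<close> has constant
  term \<open>P\<^sub>y(0, 0) \<noteq> 0\<close>, which forces \<open>F = 0\<close>.\<close>

lemma h_pos: "h > 0"
proof (rule ccontr)
  assume "\<not> h > 0"
  then have deg: "degree (coeff P j) = 0" for j
    using degree_x_le_P by (simp add: degree_x_le_def)
  have "coeff (coeff P 0) 0 = 0"
    using P by (simp add: furstenberg_poly_def poly_0_coeff_0)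
  then have "coeff P 0 = 0" using deg[of 0] by (metis leading_coeff_0_iff)
  then obtain R where R: "P = pCons 0 R" by (cases P) auto
  have "fps_nth (poly (fps_poly R) F) 0 = coeff (coeff P 1) 0"
    using F by (simp add: poly_fps_nth_0 furstenberg_series_def R poly_0_coeff_0)
  then have "poly (fps_poly R) F \<noteq> 0" using coeff_0_1_P by auto
  moreover have "F * poly (fps_poly R) F = 0"
    using F by (simp add: furstenberg_series_def R map_poly_pCons)
  ultimately show False using F0 by simp
qed

section \<open>The orbit of the initial polynomial under the digit 0\<close>

definition orbit :: "nat \<Rightarrow> 'a poly poly" where
  "orbit e = (cartier2 P 0 ^^ e) (initial_poly P)"

text \<open>Exponents of \<open>x\<close> up to \<open>q * h\<close> are read at
  \<open>q * i + r\<close>, so \<open>i \<le> h\<close>, with strict inequality once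
  \<open>r > 0\<close>.\<close>

lemma cartier2_box:
  assumes "S \<in> box h (d - 1)"
  shows "cartier2 P r S \<in> box h (d - 1)" "r > 0 \<Longrightarrow> cartier2 P r S \<in> box (h - 1) (d - 1)"
proof -
  have e: "h + (CARD('a) - 1) * h = CARD('a) * h"
    using card_field_pos[where 'a = 'a] by (cases "CARD('a)") auto
  have S: "degree_x_le S h" "degree S \<le> d - 1" using assms by (auto simp: box_def)
  have deg: "degree (cartier2 P r S) \<le> d - 1"
    using S d_pos by (intro degree_cartier2) (simp_all add: d)
  have "h + (CARD('a) - 1) * h < CARD('a) * (h + 1) + r"
    unfolding e using card_field_pos[where 'a = 'a] by (simp add: algebra_simps)
  from degree_x_cartier2[OF degree_x_le_P S(1) this] deg
  show "cartier2 P r S \<in> box h (d - 1)" by (simp add: box_def)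
  assume "r > 0"
  then have "h + (CARD('a) - 1) * h < CARD('a) * (h - 1 + 1) + r"
    unfolding e using h_pos by simp
  from degree_x_cartier2[OF degree_x_le_P S(1) this] deg
  show "cartier2 P r S \<in> box (h - 1) (d - 1)" by (simp add: box_def)
qed

text \<open>Now the degree in \<open>x\<close> of the product is at most \<open>q * h - 1\<close>,
  so \<open>i = h\<close> is excluded for every \<open>r\<close>.\<close>

lemma cartier2_small_box:
  assumes "S \<in> box (h - 1) (d - 1)"
  shows "cartier2 P r S \<in> box (h - 1) (d - 1)"
proof -
  have S: "degree_x_le S (h - 1)" "degree S \<le> d - 1" using assms by (auto simp: box_def)
  have "degree (cartier2 P r S) \<le> d - 1"
    using S d_pos by (intro degree_cartier2) (simp_all add: d)
  moreover have "h - 1 + (CARD('a) - 1) * h < CARD('a) * (h - 1 + 1) + r"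
    using card_field_pos[where 'a = 'a] h_pos by (cases "CARD('a)"; cases h) auto
  from degree_x_cartier2[OF degree_x_le_P S(1) this]
  have "degree_x_le (cartier2 P r S) (h - 1)" .
  ultimately show ?thesis by (simp add: box_def)
qed

lemma orbit_box: "orbit e \<in> box h (d - 1)"
proof (induction e)
  case 0
  then show ?case
    using degree_initial_poly[of P] degree_x_le_initial_poly[OF degree_x_le_P] d_pos
    by (simp add: orbit_def box_def d)
next
  case (Suc e)
  then show ?case using cartier2_box(1)[OF Suc, of 0] by (simp add: orbit_def)
qed

lemma border_orbit:
  "border h (d - 1) (orbit e) =
    ((cartier (coeff P d) ^^ e) (coeff (orbit 0) (d - 1)),
     (cartier (x_coeff 0 P) ^^ e) (pCons 0 (x_coeff 0 (orbit 0))),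
     (cartier (x_coeff h P) ^^ e) (pCons 0 (x_coeff h (orbit 0))))"
proof (induction e)
  case 0
  then show ?case by (simp add: border_def)
next
  case (Suc e)
  have S: "degree_x_le (orbit e) h" "degree (orbit e) \<le> d - 1"
    using orbit_box[of e] by (auto simp: box_def)
  have "orbit (Suc e) = cartier2 P 0 (orbit e)" by (simp add: orbit_def)
  moreover have "coeff (cartier2 P 0 (orbit e)) (d - 1) = cartier (coeff P d) (coeff (orbit e) (d - 1))"
    using S d_pos by (intro coeff_top_cartier2) (simp_all add: d)
  ultimately show ?case
    using Suc x_coeff_0_cartier2[of P "orbit e"] x_coeff_top_cartier2[OF degree_x_le_P S(1)]
    by (simp add: border_def)
qed

lemma degree_x_coeff_le: "degree S \<le> n \<Longrightarrow> degree (x_coeff i S) \<le> n"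
  by (rule degree_le) (simp add: coeff_eq_0)

text \<open>The three denominators are the coefficient of \<open>y^d\<close>, of degree at most
  \<open>h\<close>, and the columns at \<open>x^0\<close> and \<open>x^h\<close>, of degree at most
  \<open>d\<close>. This explains the arguments \<open>h\<close>, \<open>d\<close>,
  \<open>d\<close>; the lcm of the three lcms is a common period.\<close>

lemma border_orbit_periodic:
  assumes k: "max h d < CARD('a) ^ k"
  obtains l where "l > 0" "l \<le> landau_lcm h d d"
    "\<And>e. e \<ge> k \<Longrightarrow> border h (d - 1) (orbit e) = border h (d - 1) (orbit (k + (e - k) mod l))"
proof -
  have p1: "coeff P d \<noteq> 0" "degree (coeff P d) \<le> h"
    using d_pos degree_x_le_P by (auto simp: d degree_x_le_def)
  have p2: "x_coeff 0 P \<noteq> 0" "degree (x_coeff 0 P) \<le> d"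
    using coeff_0_1_P by (metis coeff_0 coeff_x_coeff) (simp add: degree_x_coeff_le d)
  have p3: "x_coeff h P \<noteq> 0" "degree (x_coeff h P) \<le> d"
    using x_coeff_h_P by (simp_all add: degree_x_coeff_le d)
  obtain i1 s1 where 1: "i1 \<in> {1..h}" "s1 \<in> parts i1"
    "\<And>l. partition_lcm s1 dvd l \<Longrightarrow> coeff P d dvd frob_poly l ^ h"
    using dvd_power_frob_poly[OF p1 h_pos] by blast
  obtain i2 s2 where 2: "i2 \<in> {1..d}" "s2 \<in> parts i2"
    "\<And>l. partition_lcm s2 dvd l \<Longrightarrow> x_coeff 0 P dvd frob_poly l ^ d"
    using dvd_power_frob_poly[OF p2 d_pos] by blast
  obtain i3 s3 where 3: "i3 \<in> {1..d}" "s3 \<in> parts i3"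
    "\<And>l. partition_lcm s3 dvd l \<Longrightarrow> x_coeff h P dvd frob_poly l ^ d"
    using dvd_power_frob_poly[OF p3 d_pos] by blast
  define l where "l = lcm (lcm (partition_lcm s1) (partition_lcm s2)) (partition_lcm s3)"
  have l: "l > 0"
    using 1(2) 2(2) 3(2) by (simp add: l_def partition_lcm_pos lcm_pos_nat)
  have dvd: "partition_lcm s1 dvd l" "partition_lcm s2 dvd l" "partition_lcm s3 dvd l"
    by (simp_all add: l_def dvd_lcmI1 dvd_lcmI2)
  have S: "degree_x_le (orbit 0) h" "degree (orbit 0) \<le> d - 1"
    using orbit_box[of 0] by (auto simp: box_def)
  have k': "h < CARD('a) ^ k" "d < CARD('a) ^ k" using k by auto
  \<comment> \<open>The extra factor \<open>y\<close> raises the bound from \<open>d - 1\<close> to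
    \<open>d\<close>, still below \<open>q ^ k\<close>.\<close>
  have u: "degree (pCons 0 (x_coeff i (orbit 0))) \<le> d" for i
    using degree_x_coeff_le[OF S(2), of i] d_pos degree_pCons_le[of 0 "x_coeff i (orbit 0)"] by linarith
  have "degree (coeff (orbit 0) (d - 1)) \<le> h"
    using S(1) by (simp add: degree_x_le_def)
  note per = cartier_funpow_periodic[OF l 1(3)[OF dvd(1)] p1(2) this k'(1)]
    cartier_funpow_periodic[OF l 2(3)[OF dvd(2)] p2(2) u k'(2)]
    cartier_funpow_periodic[OF l 3(3)[OF dvd(3)] p3(2) u k'(2)]
  show ?thesis
  proof (rule that[of l])
    show "l \<le> landau_lcm h d d"
      unfolding l_def by (rule lcm_le_landau_lcm) (use 1 2 3 in auto)
    fix e assume "e \<ge> k"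
    then show "border h (d - 1) (orbit e) = border h (d - 1) (orbit (k + (e - k) mod l))"
      unfolding border_orbit using per by (simp add: funpow_eventually_periodic[where k = k and l = l and e = e])
  qed (rule l)
qed

lemma finite_range_orbit: "finite (range orbit)"
  by (rule finite_subset[OF _ finite_box[of h "d - 1"]]) (use orbit_box in auto)

text \<open>The first \<open>k\<close> members are counted singly. The later ones have at most
  \<open>l\<close> different borders, and each border leaves only the inner coefficients
  free.\<close>

lemma card_range_orbit:
  assumes k: "max h d < CARD('a) ^ k"
  shows "card (range orbit) \<le> k + landau_lcm h d d * CARD('a) ^ ((h - 1) * (d - 1))"
proof -
  let ?N = "CARD('a) ^ ((h - 1) * (d - 1))"
  obtain l where l: "l > 0" "l \<le> landau_lcm h d d"
    and per: "\<And>e. e \<ge> k \<Longrightarrow> border h (d - 1) (orbit e) = border h (d - 1) (orbit (k + (e - k) mod l))"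
    using border_orbit_periodic[OF k] by blast
  define Y where "Y = (\<lambda>t. {S \<in> box h (d - 1). border h (d - 1) S = border h (d - 1) (orbit (k + t))})"
  have finY: "finite (Y t)" for t
    unfolding Y_def by (rule finite_subset[OF _ finite_box[of h "d - 1"]]) auto
  have "range orbit \<subseteq> orbit ` {..<k} \<union> (\<Union>t\<in>{..<l}. Y t)"
  proof
    fix S assume "S \<in> range orbit"
    then obtain e where e: "S = orbit e" by auto
    show "S \<in> orbit ` {..<k} \<union> (\<Union>t\<in>{..<l}. Y t)"
    proof (cases "e < k")
      case False
      then have "S \<in> Y ((e - k) mod l)" using per[of e] orbit_box by (simp add: Y_def e)
      moreover have "(e - k) mod l < l" using l by simp
      ultimately show ?thesis by blast
    qed (use e in auto)
  qed
  then have "card (range orbit) \<le> card (orbit ` {..<k} \<union> (\<Union>t\<in>{..<l}. Y t))"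
    using finY by (intro card_mono) auto
  also have "\<dots> \<le> card (orbit ` {..<k}) + card (\<Union>t\<in>{..<l}. Y t)"
    by (rule card_Un_le)
  also have "\<dots> \<le> k + (\<Sum>t<l. card (Y t))"
    using card_image_le[of "{..<k}" orbit] card_UN_le[of "{..<l}" Y] by simp
  also have "(\<Sum>t<l. card (Y t)) \<le> (\<Sum>t<l. ?N)"
    unfolding Y_def by (intro sum_mono card_box_border)
  also have "\<dots> \<le> landau_lcm h d d * ?N" using l by simp
  finally show ?thesis by simp
qed

lemma admissible_automaton_bound:
  assumes k: "max h d < CARD('a) ^ k"
  obtains M where "admissible_automaton CARD('a) (fps_nth F) M"
    "card (states M) \<le> CARD('a) ^ (h * d) + CARD('a) ^ ((h - 1) * (d - 1)) * landau_lcm h d d + k"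
proof -
  let ?q = "CARD('a)"
  \<comment> \<open>The small box has \<open>h * d\<close> coefficients. The states are the series
    attached to \<open>Z\<close>, so distinct polynomials may merge and the count can only
    drop.\<close>
  define Z where "Z = box (h - 1) (d - 1) \<union> range orbit"
  define X where "X = residue_series P F ` Z"
  have finZ: "finite Z" by (simp add: Z_def finite_box finite_range_orbit)
  have "card X \<le> card Z" unfolding X_def by (rule card_image_le[OF finZ])
  also have "\<dots> \<le> card (box (h - 1) (d - 1) :: 'a poly poly set) + card (range orbit)"
    unfolding Z_def by (rule card_Un_le)
  also have "\<dots> \<le> ?q ^ (h * d) + ?q ^ ((h - 1) * (d - 1)) * landau_lcm h d d + k"
    using card_box[of "h - 1" "d - 1", where 'a = 'a] card_range_orbit[OF k] h_pos d_pos
    by (simp add: mult.commute)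
  finally have card: "card X \<le> ?q ^ (h * d) + ?q ^ ((h - 1) * (d - 1)) * landau_lcm h d d + k" .
  \<comment> \<open>The small box is closed under all digits; on the orbit, 0 advances and every
    other digit leads into the small box.\<close>
  have closed: "cartier2 P r S \<in> Z" if S: "S \<in> Z" for r S
  proof (cases "S \<in> box (h - 1) (d - 1)")
    case True
    then show ?thesis unfolding Z_def by (intro UnI1 cartier2_small_box)
  next
    case False
    then obtain e where e: "S = orbit e" using S by (auto simp: Z_def)
    show ?thesis
    proof (cases "r = 0")
      case True
      have "cartier2 P 0 (orbit e) = orbit (Suc e)" by (simp add: orbit_def)
      then show ?thesis by (simp add: Z_def e True)
    next
      case False
      then show ?thesis using cartier2_box(2)[OF orbit_box] by (simp add: Z_def e)
    qed
  qed
  have "orbit 0 \<in> Z" by (simp add: Z_def)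
  then have "F \<in> X"
    unfolding X_def using residue_series_initial[OF P F] by (force simp: orbit_def)
  moreover have "fps_section ?q r G \<in> X" if "G \<in> X" "r < ?q" for G r
    using that closed by (auto simp: X_def residue_series_section[OF P F])
  moreover have "?q \<ge> 2" using card_field_gt_1[where 'a = 'a] by simp
  ultimately obtain M where "admissible_automaton ?q (fps_nth F) M" "card (states M) = card X"
    using admissible_automaton_exists[of ?q X F] finZ by (auto simp: X_def)
  then show ?thesis using that card by simp
qed

end

theorem theorem1:
  fixes P :: "'a::{field,finite} poly poly" and F :: "'a fps" and q h d :: nat
  assumes "q = CARD('a)"
    and "furstenberg_poly P"
    and "h = degree_x P" and "d = degree P"
    and "furstenberg_series P F" and "F \<noteq> 0"
  shows "(\<exists>M. minimal_automaton q (fps_nth F) M) \<and>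
    (\<forall>M. minimal_automaton q (fps_nth F) M \<longrightarrow>
      int (card (states M)) \<le>
        int (q ^ (h * d)) + int (q ^ ((h - 1) * (d - 1))) * int (landau_lcm h d d)
        + \<lfloor>log (real q) (real h)\<rfloor> + \<lfloor>log (real q) (real (max h d))\<rfloor> + 3)"
proof -
  have h: "h > 0" by (rule h_pos[OF assms(2-6)])
  have q: "real q > 1" using card_field_gt_1[where 'a = 'a] by (simp add: assms(1))
  \<comment> \<open>The least exponent for which \<open>q ^ k\<close> exceeds
    \<open>max h d\<close>.\<close>
  define k where "k = nat (\<lfloor>log q (max h d)\<rfloor> + 1)"
  have log_max: "log q (max h d) \<ge> 0" and log_h: "log q h \<ge> 0"
    using h q by simp_all
  then have k: "int k = \<lfloor>log q (max h d)\<rfloor> + 1" by (simp add: k_def)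
  have "log q (max h d) < k"
    using k by linarith
  then have "real (max h d) < q powr k"
    using h q by (subst (asm) log_less_iff) auto
  then have "max h d < CARD('a) ^ k"
    using q by (simp add: powr_realpow assms(1) del: max_less_iff_conj of_nat_max flip: of_nat_power)
  then obtain M0 where M0: "admissible_automaton q (fps_nth F) M0"
    "card (states M0) \<le> q ^ (h * d) + q ^ ((h - 1) * (d - 1)) * landau_lcm h d d + k"
    using admissible_automaton_bound[OF assms(2-6)] unfolding assms(1) by blast
  have "int (card (states M)) \<le>
        int (q ^ (h * d)) + int (q ^ ((h - 1) * (d - 1))) * int (landau_lcm h d d)
        + \<lfloor>log (real q) (real h)\<rfloor> + \<lfloor>log (real q) (real (max h d))\<rfloor> + 3"
    if "minimal_automaton q (fps_nth F) M" for M
  proof -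
    have "card (states M) \<le> card (states M0)"
      using that M0(1) by (simp add: minimal_automaton_def)
    then have "card (states M) \<le> q ^ (h * d) + q ^ ((h - 1) * (d - 1)) * landau_lcm h d d + k"
      using M0(2) by linarith
    then have "int (card (states M)) \<le>
        int (q ^ (h * d) + q ^ ((h - 1) * (d - 1)) * landau_lcm h d d + k)"
      by (simp only: of_nat_le_iff)
    also have "\<dots> = int (q ^ (h * d)) + int (q ^ ((h - 1) * (d - 1))) * int (landau_lcm h d d) + int k"
      by (simp only: of_nat_add of_nat_mult)
    \<comment> \<open>Since the floor of \<open>log q h\<close> is nonnegative, \<open>k\<close> is
      at most the sum of both floors and 3.\<close>
    finally show ?thesis
      using k log_h by (smt (verit) zero_le_floor)
  qed
  then show ?thesis using minimal_automaton_exists[OF M0(1)] by blast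
qed

end
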